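(* The following hold. 1. Let $q$ be a prime power and $d$ a positive integer, with $d\geq 2$ if $q=2$, and let $k=(q-1)d-2$. Then the Reed-Muller code $\mathcal{RM}_q(k,d)$ is completely transitive and $1$-elusive, with parameters $[q^d,\,q^d-d-1,\,\delta]$, where $\delta=4$ if $q=2$ and $\delta=3$ otherwise. 2. For every integer $d\geq 2$, the Preparata codes $\mathcal{P}(2d)$ in $H(2^{2d},2)$ (which are non-linear) are $2$-elusive, with minimum distance $\delta=6$ and size $2^{2^{2d}-4d}$. 3. The punctured code of the even weight subcode of the perfect binary Golay code is $3$-elusive with parameters $[22,11,7]$.
   Context: Hamming graph: for finite sets $M$, $Q$ of sizes $m$, $q$, the graph $\varGamma=H(m,q)$ has as vertices all $m$-tuples with entries indexed by $M$ and taken from $Q$; two vertices are adjacent iff they differ in exactly one entry. $d(\alpha,\beta)$ is the Hamming distance. $\mathrm{Aut}(\varGamma)$ is the full automorphism group of the graph (isomorphic to $S_q^m\rtimes S_m$); the image of a set $C$ of vertices under $x\in\mathrm{Aut}(\varGamma)$ is denoted $C^x$. A code $C$ in $H(m,q)$ is a subset of the vertex set. Its minimum distance is $\delta=\min\{d(\alpha,\beta)\mid \alpha,\beta\in C,\ \alpha\neq\beta\}$. For a vertex $\alpha$, $d(\alpha,C)=\min\{d(\alpha,\beta)\mid\beta\in C\}$; the covering radius $\rho$ of $C$ is the maximum of $d(\alpha,C)$ over all vertices $\alpha$; for $0\le r\leq\rho$ the set of $r$-neighbours of $C$ is $C_r=\{\alpha\mid d(\alpha,C)=r\}$. $\mathrm{Aut}(C)$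 is the setwise stabiliser of $C$ in $\mathrm{Aut}(\varGamma)$. Codes $C,C'$ in $H(m,q)$ are equivalent if $C'=C^x$ for some $x\in\mathrm{Aut}(\varGamma)$. For an integer $s$ with $1\leq s\leq\rho$, $C$ is $s$-elusive if there exists a code $C'\neq C$ equivalent to $C$ with $C_s=C'_s$. $C$ is $G$-completely transitive, for $G\leq \mathrm{Aut}(C)$, if each $C_i$, $i\in\{0,\ldots,\rho\}$ (with $C_0=C$), is a $G$-orbit; $C$ is completely transitive if it is $G$-completely transitive for some $G\leq\mathrm{Aut}(C)$. A code is linear if $Q=\mathbb{F}_q$ and $C$ is a subspace of $\mathbb{F}_q^m$; it has parameters $[m,\ell,\delta]$ if it has length $m$, dimension $\ell$ and minimum distance $\delta$. Reed-Muller codes: let $Q=\mathbb{F}_q$ and $M=\mathbb{F}_q^d$, so vertices of $H(q^d,q)$ are tuples $\alpha=(\alpha_v)_{v\in M}$ with $\alpha_v\in\mathbb{F}_q$. For $k=(q-1)d-2$, $\mathcal{RM}_q(k,d)$ is the set of all $\alpha$ with $\sum_{v\in M}\alpha_v=0$ (in $\mathbb{F}_q$) and $\sum_{v\in M}\alpha_v v=0$ (in $\mathbb{F}_q^d$). (This is the dual of the first order generalised Reed-Muller code.) Preparata codes: let $d\geq2$, $F=\mathbb{F}_{2^{2d-1}}$, and let $\sigma$ be a power of $2$ such that both maps $x\mapsto x^{\sigma+1}$ and $x\mapsto x^{\sigma-1}$ are bijections of $F$. A vertex of $H(2^{2d},2)$ is identified with a pair $(X,Y)$ of subsets of $F$ (the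 coordinates being indexed by two disjoint copies of $F$, and $X$, $Y$ being the parts of the support in the first and second copy). The Preparata code $\mathcal{P}(2d)$ (for an arbitrary such $\sigma$) is the set of all $(X,Y)$ such that: (i) $|X|$ and $|Y|$ are even; (ii) $\sum_{x\in X}x=\sum_{y\in Y}y$; (iii) $\sum_{x\in X}x^{\sigma+1}+\left(\sum_{x\in X}x\right)^{\sigma+1}=\sum_{y\in Y}y^{\sigma+1}$. Golay code: the perfect binary Golay code is the (unique up to equivalence) linear $[23,12,7]$ code in $H(23,2)$. The even weight subcode of a binary code is the set of its codewords with an even number of non-zero entries. Puncturing a code means deleting one fixed coordinate from every codeword. *)

theory Defs
  imports
    "HOL-Analysis.Cartesian_Space"
    "HOL-Algebra.Bij"
    "HOL-Algebra.Group_Action"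
    "HOL-Library.Z2"
begin

text \<open>
  The vertex set of the Hamming graph with coordinate set \<open>M\<close> and alphabet \<open>Q\<close> is the type
  \<open>'q^'m\<close>, where the finite types \<open>'m\<close> and \<open>'q\<close> play the roles of \<open>M\<close> and \<open>Q\<close>.
  A code is a set of vertices.
\<close>

instance bit :: finite
proof
  have "(UNIV :: bit set) = {0, 1}"
    by (auto intro: bit.exhaust)
  then show "finite (UNIV :: bit set)"
    by (metis finite.emptyI finite.insertI)
qed

definition hamming_dist :: "'q ^ 'm \<Rightarrow> 'q ^ 'm \<Rightarrow> nat" where
  "hamming_dist \<alpha> \<beta> = card {i. \<alpha> $ i \<noteq> \<beta> $ i}"

definition hamming_adj :: "'q ^ 'm \<Rightarrow> 'q ^ 'm \<Rightarrow> bool" where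
  "hamming_adj \<alpha> \<beta> \<longleftrightarrow> card {i. \<alpha> $ i \<noteq> \<beta> $ i} = 1"

definition HammingAut :: "('q ^ 'm \<Rightarrow> 'q ^ 'm) monoid" where
  "HammingAut = BijGroup UNIV
     \<lparr>carrier := {x \<in> Bij UNIV. \<forall>\<alpha> \<beta>. hamming_adj (x \<alpha>) (x \<beta>) \<longleftrightarrow> hamming_adj \<alpha> \<beta>}\<rparr>"

definition CodeAut :: "('q ^ 'm) set \<Rightarrow> ('q ^ 'm \<Rightarrow> 'q ^ 'm) monoid" where
  "CodeAut C = HammingAut \<lparr>carrier := {x \<in> carrier HammingAut. x ` C = C}\<rparr>"

definition code_equivalent :: "('q ^ 'm) set \<Rightarrow> ('q ^ 'm) set \<Rightarrow> bool" where
  "code_equivalent C C' \<longleftrightarrow> (\<exists>x \<in> carrier HammingAut. C' = x ` C)"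

text \<open>
  The minima and maxima below range over finite sets for a finite alphabet. The value of
  \<open>min_distance\<close> is unspecified for codes with fewer than two codewords, and that of
  \<open>dist_to_code\<close> for the empty code.
\<close>

definition min_distance :: "('q::finite ^ 'm) set \<Rightarrow> nat" where
  "min_distance C = Min {hamming_dist \<alpha> \<beta> | \<alpha> \<beta>. \<alpha> \<in> C \<and> \<beta> \<in> C \<and> \<alpha> \<noteq> \<beta>}"

definition dist_to_code :: "'q::finite ^ 'm \<Rightarrow> ('q ^ 'm) set \<Rightarrow> nat" where
  "dist_to_code \<alpha> C = Min {hamming_dist \<alpha> \<beta> | \<beta>. \<beta> \<in> C}"

definition covering_radius :: "('q::finite ^ 'm) set \<Rightarrow> nat" where
  "covering_radius C = Max {dist_to_code \<alpha> C | \<alpha>. \<alpha> \<in> UNIV}"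

definition neighbours :: "('q::finite ^ 'm) set \<Rightarrow> nat \<Rightarrow> ('q ^ 'm) set" where
  "neighbours C r = {\<alpha>. dist_to_code \<alpha> C = r}"

definition elusive :: "nat \<Rightarrow> ('q::finite ^ 'm) set \<Rightarrow> bool" where
  "elusive s C \<longleftrightarrow> 1 \<le> s \<and> s \<le> covering_radius C \<and>
     (\<exists>C'. C' \<noteq> C \<and> code_equivalent C C' \<and> neighbours C s = neighbours C' s)"

definition completely_transitive_wrt ::
  "('q::finite ^ 'm \<Rightarrow> 'q ^ 'm) set \<Rightarrow> ('q ^ 'm) set \<Rightarrow> bool" where
  "completely_transitive_wrt G C \<longleftrightarrow> subgroup G (CodeAut C) \<and>
     (\<forall>i \<le> covering_radius C. \<exists>\<alpha>.
        neighbours C i = orbit (CodeAut C \<lparr>carrier := G\<rparr>) (\<lambda>g. g) \<alpha>)"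

definition completely_transitive :: "('q::finite ^ 'm) set \<Rightarrow> bool" where
  "completely_transitive C \<longleftrightarrow> (\<exists>G. completely_transitive_wrt G C)"

definition linear_code_params ::
  "('q::{field,finite} ^ 'm) set \<Rightarrow> nat \<Rightarrow> nat \<Rightarrow> nat \<Rightarrow> bool" where
  "linear_code_params C m l \<delta> \<longleftrightarrow>
     vec.subspace C \<and> CARD('m) = m \<and> vec.dim C = l \<and> min_distance C = \<delta>"

text \<open>
  With \<open>q = CARD('q)\<close> and \<open>d = CARD('d)\<close>, this is the Reed-Muller code of order
  \<open>k = (q - 1) * d - 2\<close>; since the order is determined by the types, it is not a parameter.
\<close>

definition reed_muller :: "('q::{field,finite} ^ ('q ^ 'd)) set" where
  "reed_muller = {\<alpha>. (\<Sum>v\<in>UNIV. \<alpha> $ v) = 0 \<and> (\<Sum>v\<in>UNIV. \<alpha> $ v *s v) = 0}"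

definition preparata_exponent :: "'f::{field,finite} itself \<Rightarrow> nat \<Rightarrow> bool" where
  "preparata_exponent _ \<sigma> \<longleftrightarrow> (\<exists>s. \<sigma> = 2 ^ s) \<and>
     bij (\<lambda>x::'f. x ^ (\<sigma> + 1)) \<and> bij (\<lambda>x::'f. x ^ (\<sigma> - 1))"

text \<open>
  A vertex \<open>\<alpha>\<close> corresponds to the pair \<open>(X, Y)\<close> of the parts of its support in the two
  summands of the index type \<open>'f + 'f\<close>.
\<close>

definition preparata :: "nat \<Rightarrow> (bit ^ ('f::{field,finite} + 'f)) set" where
  "preparata \<sigma> = {\<alpha>.
     let X = {x. \<alpha> $ Inl x \<noteq> 0}; Y = {y. \<alpha> $ Inr y \<noteq> 0} in
       even (card X) \<and> even (card Y) \<and>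
       (\<Sum>x\<in>X. x) = (\<Sum>y\<in>Y. y) \<and>
       (\<Sum>x\<in>X. x ^ (\<sigma> + 1)) + (\<Sum>x\<in>X. x) ^ (\<sigma> + 1) = (\<Sum>y\<in>Y. y ^ (\<sigma> + 1))}"

definition binary_golay :: "(bit ^ 'n) set \<Rightarrow> bool" where
  "binary_golay C \<longleftrightarrow> linear_code_params C 23 12 7"

definition even_weight_subcode :: "(bit ^ 'n) set \<Rightarrow> (bit ^ 'n) set" where
  "even_weight_subcode C = {c \<in> C. even (card {i. c $ i \<noteq> 0})}"

text \<open>
  Deleting the coordinate \<open>j\<close> leaves words indexed by \<open>UNIV - {j}\<close>, which is not a type; a
  bijection \<open>e\<close> from \<open>'m\<close> onto \<open>UNIV - {j}\<close> names the remaining coordinates.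
\<close>

definition puncture :: "('m \<Rightarrow> 'n) \<Rightarrow> ('q ^ 'n) set \<Rightarrow> ('q ^ 'm) set" where
  "puncture e C = {\<chi> i. c $ e i | c. c \<in> C}"

end

theory Submission
  imports Defs
begin

text \<open>
  In each family the second code with the same \<open>s\<close>-neighbours is a translate of the first. Elusiveness
  holds because the set of \<open>s\<close>-neighbours has more translational symmetry than the code.

  Reed-Muller codes: a word has the two invariants \<open>coord_sum\<close> (the sum of its entries) and \<open>moment\<close>
  (the sum of its entries times their positions), and the code is where both vanish. A change of one
  entry can correct every pair of invariants with nonzero first component. Hence the 1-neighbours
  are exactly the words with nonzero \<open>coord_sum\<close> (lemma \<open>neighbours_reed_muller\<close>), and translation
  by a word with \<open>coord_sum\<close> zero preserves them. For complete transitivity, translations by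
  codewords are transitive on the words with given invariants, while scalars and affine permutations
  of the positions act on the invariants with exactly three orbits (\<open>affine_moves_neighbour\<close>).

  Preparata codes: the code lies in an extended Hamming code \<open>supercode\<close> of minimum distance 4 and
  has itself minimum distance at least 6 (\<open>preparata_dist_ge_6\<close>), because \<open>u ^ \<sigma> = u + 1\<close> has no
  solution. The additive map \<open>syndrome\<close> is surjective, which gives the size of the code. With this
  size, the disjoint spheres of radius 2 around the codewords have as many elements as there are
  words of even weight outside \<open>supercode\<close>, so these words are precisely the 2-neighbours
  (\<open>words_at_distance_2\<close>). They are preserved by translation by any element of the linear code
  \<open>supercode\<close>, but the code is not.

  Golay code: a [23, 12, 7] code is perfect by counting. Let \<open>D\<close> and \<open>D'\<close> be the punctured codes of
  its even and odd codewords; they are translates of each other. If \<open>z\<close> is at distance 3 from a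
  punctured codeword, then the extension of \<open>z\<close> by the wrong entry at the deleted coordinate is at
  distance 4 from that codeword, and perfectness provides a codeword of the other parity within
  distance 3 (\<open>dist_3_other_parity\<close>). So \<open>D\<close> and \<open>D'\<close> have the same 3-neighbours.
\<close>

section \<open>The Hamming metric\<close>

lemma hamming_dist_eq_0_iff: "hamming_dist \<alpha> \<beta> = 0 \<longleftrightarrow> \<alpha> = \<beta>"
  by (simp add: hamming_dist_def vec_eq_iff)

lemma hamming_dist_self [simp]: "hamming_dist \<alpha> \<alpha> = 0"
  by (simp add: hamming_dist_def)

lemma hamming_dist_commute: "hamming_dist \<alpha> \<beta> = hamming_dist \<beta> \<alpha>"
  unfolding hamming_dist_def by (rule arg_cong[where f = card]) auto

lemma hamming_dist_triangle: "hamming_dist \<alpha> \<gamma> \<le> hamming_dist \<alpha> \<beta> + hamming_dist \<beta> \<gamma>"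
proof -
  have "hamming_dist \<alpha> \<gamma> \<le> card ({i. \<alpha> $ i \<noteq> \<beta> $ i} \<union> {i. \<beta> $ i \<noteq> \<gamma> $ i})"
    unfolding hamming_dist_def by (rule card_mono) auto
  also have "\<dots> \<le> hamming_dist \<alpha> \<beta> + hamming_dist \<beta> \<gamma>"
    unfolding hamming_dist_def by (rule card_Un_le)
  finally show ?thesis .
qed

lemma hamming_dist_add [simp]:
  "hamming_dist (\<alpha> + \<eta>) (\<beta> + \<eta>) = hamming_dist \<alpha> (\<beta> :: 'q::ab_group_add ^ 'm)"
  by (simp add: hamming_dist_def)

lemma hamming_dist_add_self [simp]:
  "hamming_dist (\<alpha> + \<eta>) \<alpha> = hamming_dist \<eta> (0 :: 'q::ab_group_add ^ 'm)"
  by (simp add: hamming_dist_def)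

lemma hamming_dist_diff_0:
  "hamming_dist (\<alpha> - \<beta>) 0 = hamming_dist \<alpha> (\<beta> :: 'q::ab_group_add ^ 'm)"
  by (simp add: hamming_dist_def)

lemma hamming_adj_iff: "hamming_adj \<alpha> \<beta> \<longleftrightarrow> hamming_dist \<alpha> \<beta> = 1"
  by (simp add: hamming_adj_def hamming_dist_def)

lemma hamming_dist_axis:
  "hamming_dist (axis v c) (0 :: 'q::zero ^ 'm) = (if c = 0 then 0 else 1)"
proof -
  have "{i. axis v c $ i \<noteq> (0 :: 'q ^ 'm) $ i} = (if c = 0 then {} else {v})"
    by (auto simp: axis_def)
  then show ?thesis by (simp add: hamming_dist_def)
qed

lemma hamming_dist_one_axis:
  assumes "hamming_dist \<alpha> (\<beta> :: 'q::ab_group_add ^ 'm) = 1"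
  obtains v c where "c \<noteq> 0" "\<alpha> = \<beta> + axis v c"
proof -
  obtain v where v: "{i. \<alpha> $ i \<noteq> \<beta> $ i} = {v}"
    using assms by (auto simp: hamming_dist_def card_1_singleton_iff)
  have "\<alpha> = \<beta> + axis v (\<alpha> $ v - \<beta> $ v)"
    using v by (auto simp: vec_eq_iff axis_def)
  moreover have "\<alpha> $ v - \<beta> $ v \<noteq> 0"
    using v by auto
  ultimately show thesis using that by blast
qed

section \<open>Distance from a code, covering radius and minimum distance\<close>

lemma dist_to_code_attained:
  fixes C :: "('q::finite ^ 'm) set"
  assumes "C \<noteq> {}"
  obtains \<beta> where "\<beta> \<in> C" "dist_to_code \<alpha> C = hamming_dist \<alpha> \<beta>"
proof -
  have "dist_to_code \<alpha> C \<in> {hamming_dist \<alpha> \<beta> | \<beta>. \<beta> \<in> C}"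
    unfolding dist_to_code_def by (rule Min_in) (use assms in auto)
  then show thesis using that by auto
qed

lemma dist_to_code_le:
  fixes C :: "('q::finite ^ 'm) set"
  assumes "\<beta> \<in> C"
  shows "dist_to_code \<alpha> C \<le> hamming_dist \<alpha> \<beta>"
  unfolding dist_to_code_def by (rule Min_le) (use assms in auto)

lemma dist_to_code_eq_iff:
  fixes C :: "('q::finite ^ 'm) set"
  assumes "C \<noteq> {}"
  shows "dist_to_code \<alpha> C = r \<longleftrightarrow>
    (\<exists>\<beta>\<in>C. hamming_dist \<alpha> \<beta> = r) \<and> (\<forall>\<beta>\<in>C. r \<le> hamming_dist \<alpha> \<beta>)"
  using dist_to_code_attained[OF assms, of \<alpha>] dist_to_code_le[of _ C \<alpha>]
  by (metis order_antisym)

lemma neighbours_0: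
  fixes C :: "('q::finite ^ 'm) set"
  assumes "C \<noteq> {}"
  shows "neighbours C 0 = C"
  using assms by (auto simp: neighbours_def dist_to_code_eq_iff hamming_dist_eq_0_iff)

lemma le_covering_radius:
  fixes C :: "('q::finite ^ 'm) set"
  assumes "neighbours C r \<noteq> {}"
  shows "r \<le> covering_radius C"
  unfolding covering_radius_def
  by (rule Max_ge) (use assms in \<open>auto simp: neighbours_def full_SetCompr_eq\<close>)

lemma covering_radius_le:
  fixes C :: "('q::finite ^ 'm) set"
  assumes "\<And>\<alpha>. dist_to_code \<alpha> C \<le> r"
  shows "covering_radius C \<le> r"
  unfolding covering_radius_def using assms by (subst Max_le_iff) (auto simp: full_SetCompr_eq)

lemma min_distance_eqI:
  fixes C :: "('q::finite ^ 'm) set"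
  assumes "\<alpha> \<in> C" "\<beta> \<in> C" "\<alpha> \<noteq> \<beta>" "hamming_dist \<alpha> \<beta> = r"
    and "\<And>\<gamma> \<delta>. \<gamma> \<in> C \<Longrightarrow> \<delta> \<in> C \<Longrightarrow> \<gamma> \<noteq> \<delta> \<Longrightarrow> r \<le> hamming_dist \<gamma> \<delta>"
  shows "min_distance C = r"
proof -
  have "finite {hamming_dist \<alpha> \<beta> | \<alpha> \<beta>. \<alpha> \<in> C \<and> \<beta> \<in> C \<and> \<alpha> \<noteq> \<beta>}"
    by (rule finite_subset[of _ "(\<lambda>(\<alpha>, \<beta>). hamming_dist \<alpha> \<beta>) ` UNIV"]) auto
  then show ?thesis
    unfolding min_distance_def by (intro Min_eqI) (use assms in auto)
qed

lemma min_distance_le: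
  fixes C :: "('q::finite ^ 'm) set"
  assumes "\<gamma> \<in> C" "\<delta> \<in> C" "\<gamma> \<noteq> \<delta>"
  shows "min_distance C \<le> hamming_dist \<gamma> \<delta>"
proof -
  have "finite {hamming_dist \<alpha> \<beta> | \<alpha> \<beta>. \<alpha> \<in> C \<and> \<beta> \<in> C \<and> \<alpha> \<noteq> \<beta>}"
    by (rule finite_subset[of _ "(\<lambda>(\<alpha>, \<beta>). hamming_dist \<alpha> \<beta>) ` UNIV"]) auto
  then show ?thesis
    unfolding min_distance_def by (rule Min_le) (use assms in auto)
qed

lemma min_distance_subspace_eqI:
  fixes C :: "('q::{field,finite} ^ 'm) set"
  assumes "vec.subspace C" "\<gamma> \<in> C" "\<gamma> \<noteq> 0" "hamming_dist \<gamma> 0 = r"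
    and "\<And>\<gamma>. \<gamma> \<in> C \<Longrightarrow> \<gamma> \<noteq> 0 \<Longrightarrow> r \<le> hamming_dist \<gamma> 0"
  shows "min_distance C = r"
proof (rule min_distance_eqI)
  show "0 \<in> C" using assms(1) by (rule vec.subspace_0)
next
  fix \<gamma> \<delta> assume "\<gamma> \<in> C" "\<delta> \<in> C" "\<gamma> \<noteq> \<delta>"
  then have "\<gamma> - \<delta> \<in> C" "\<gamma> - \<delta> \<noteq> 0" using assms(1) by (auto intro: vec.subspace_diff)
  then show "r \<le> hamming_dist \<gamma> \<delta>" using assms(5) by (metis hamming_dist_diff_0)
qed (use assms(2-4) in \<open>auto simp: hamming_dist_commute\<close>)

section \<open>Automorphisms of the Hamming graph\<close>

lemma HammingAutI:
  assumes "bij x" "\<And>\<alpha> \<beta>. hamming_dist (x \<alpha>) (x \<beta>) = hamming_dist \<alpha> \<beta>"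
  shows "x \<in> carrier HammingAut"
  using assms by (auto simp: HammingAut_def Bij_def hamming_adj_iff)

text \<open>
  Preservation of adjacency suffices for being an isometry because the Hamming distance is the
  path metric of the graph: a vertex at distance \<open>r + 1\<close> from \<open>\<alpha>\<close> has a neighbour at
  distance \<open>r\<close> from \<open>\<alpha>\<close>, so that distances cannot grow under an automorphism or its inverse.
\<close>

lemma adj_preserving_dist_le:
  assumes "\<And>\<alpha> \<beta>. hamming_adj \<alpha> \<beta> \<Longrightarrow> hamming_adj (x \<alpha>) (x \<beta>)"
  shows "hamming_dist (x \<alpha>) (x \<beta>) \<le> hamming_dist \<alpha> \<beta>"
proof (induction "hamming_dist \<alpha> \<beta>" arbitrary: \<beta>)
  case 0
  then show ?case by (metis hamming_dist_eq_0_iff le_refl)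
next
  case (Suc r)
  then have "{i. \<alpha> $ i \<noteq> \<beta> $ i} \<noteq> {}"
    unfolding hamming_dist_def by (metis card.empty nat.distinct(1))
  then obtain v where v: "\<alpha> $ v \<noteq> \<beta> $ v" by auto
  define \<gamma> where "\<gamma> = (\<chi> i. if i = v then \<alpha> $ v else \<beta> $ i)"
  have "{i. \<alpha> $ i \<noteq> \<gamma> $ i} = {i. \<alpha> $ i \<noteq> \<beta> $ i} - {v}"
    by (auto simp: \<gamma>_def)
  then have r: "r = hamming_dist \<alpha> \<gamma>"
    using Suc.hyps(2) v by (simp add: hamming_dist_def)
  have "{i. \<gamma> $ i \<noteq> \<beta> $ i} = {v}"
    using v by (auto simp: \<gamma>_def)
  then have "hamming_adj \<gamma> \<beta>" by (simp add: hamming_adj_def)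
  then have "hamming_dist (x \<gamma>) (x \<beta>) = 1" using assms by (simp add: hamming_adj_iff)
  then have "hamming_dist (x \<alpha>) (x \<beta>) \<le> hamming_dist (x \<alpha>) (x \<gamma>) + 1"
    by (metis hamming_dist_triangle)
  also have "\<dots> \<le> r + 1" using Suc.hyps(1)[OF r] r by simp
  finally show ?case using Suc.hyps(2) by simp
qed

lemma HammingAut_dist:
  assumes "x \<in> carrier HammingAut"
  shows "hamming_dist (x \<alpha>) (x \<beta>) = hamming_dist \<alpha> \<beta>"
proof (rule order_antisym)
  have x: "bij x" and adj: "\<And>\<alpha> \<beta>. hamming_adj (x \<alpha>) (x \<beta>) \<longleftrightarrow> hamming_adj \<alpha> \<beta>"
    using assms by (auto simp: HammingAut_def Bij_def)
  show "hamming_dist (x \<alpha>) (x \<beta>) \<le> hamming_dist \<alpha> \<beta>"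
    by (rule adj_preserving_dist_le) (simp add: adj)
  have "hamming_dist (Hilbert_Choice.inv x (x \<alpha>)) (Hilbert_Choice.inv x (x \<beta>)) \<le> hamming_dist (x \<alpha>) (x \<beta>)"
    by (rule adj_preserving_dist_le) (metis adj x bij_inv_eq_iff)
  then show "hamming_dist \<alpha> \<beta> \<le> hamming_dist (x \<alpha>) (x \<beta>)"
    using x by (simp add: bij_is_inj)
qed

lemma dist_to_code_image:
  fixes C :: "('q::finite ^ 'm) set"
  assumes "x \<in> carrier HammingAut"
  shows "dist_to_code (x \<alpha>) (x ` C) = dist_to_code \<alpha> C"
proof -
  have "{hamming_dist (x \<alpha>) \<beta> | \<beta>. \<beta> \<in> x ` C} = {hamming_dist \<alpha> \<beta> | \<beta>. \<beta> \<in> C}"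
    using HammingAut_dist[OF assms] by (auto simp: image_iff) metis
  then show ?thesis by (simp add: dist_to_code_def)
qed

lemma neighbours_image:
  fixes C :: "('q::finite ^ 'm) set"
  assumes "x \<in> carrier HammingAut"
  shows "neighbours (x ` C) r = x ` neighbours C r"
proof -
  have "surj x" using assms by (auto simp: HammingAut_def Bij_def bij_is_surj)
  then show ?thesis
    using dist_to_code_image[OF assms, of _ C]
    by (auto simp: neighbours_def image_iff) (metis surjD)
qed

lemma translation_HammingAut:
  "(\<lambda>\<alpha>. \<alpha> + \<eta>) \<in> carrier (HammingAut :: ('q::ab_group_add ^ 'm \<Rightarrow> _) monoid)"
proof (rule HammingAutI)
  show "bij (\<lambda>\<alpha>. \<alpha> + \<eta>)"
    by (rule bij_betw_byWitness[where f' = "\<lambda>\<alpha>. \<alpha> - \<eta>"]) auto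
qed simp

lemma elusive_translateI:
  fixes C :: "('q::{ab_group_add,finite} ^ 'm) set"
  assumes "1 \<le> s" "neighbours C s \<noteq> {}" "(\<lambda>\<alpha>. \<alpha> + \<eta>) ` C \<noteq> C"
    and "(\<lambda>\<alpha>. \<alpha> + \<eta>) ` neighbours C s = neighbours C s"
  shows "elusive s C"
  unfolding elusive_def code_equivalent_def
  using assms translation_HammingAut[of \<eta>] neighbours_image[OF translation_HammingAut[of \<eta>], of C s]
    le_covering_radius[OF assms(2)]
  by (metis (no_types, lifting))

lemma group_CodeAut: "group (CodeAut C)"
proof -
  interpret B: group "BijGroup UNIV" by (rule group_BijGroup)
  let ?H = "{x \<in> Bij UNIV. (\<forall>\<alpha> \<beta>. hamming_adj (x \<alpha>) (x \<beta>) \<longleftrightarrow> hamming_adj \<alpha> \<beta>) \<and> x ` C = C}"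
  have comp: "compose UNIV f g = f \<circ> g" for f g :: "'a ^ 'b \<Rightarrow> 'a ^ 'b"
    by (auto simp: compose_def)
  have "subgroup ?H (BijGroup UNIV)"
  proof (rule B.subgroupI)
    show "?H \<subseteq> carrier (BijGroup UNIV)" by (auto simp: BijGroup_def)
    have "id \<in> ?H" by (auto simp: Bij_def)
    then show "?H \<noteq> {}" by blast
  next
    fix f assume f: "f \<in> ?H"
    then have "bij f" by (auto simp: Bij_def)
    moreover have "inv\<^bsub>BijGroup UNIV\<^esub> f = Hilbert_Choice.inv f"
      using f by (simp add: inv_BijGroup restrict_def)
    moreover have "Hilbert_Choice.inv f ` C = C"
      using f image_inv_f_f[OF bij_is_inj[OF \<open>bij f\<close>], of C] by simp
    moreover have "hamming_adj (Hilbert_Choice.inv f \<alpha>) (Hilbert_Choice.inv f \<beta>) \<longleftrightarrow> hamming_adj \<alpha> \<beta>" for \<alpha> \<beta>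
    proof -
      have "f (Hilbert_Choice.inv f \<gamma>) = \<gamma>" for \<gamma>
        using \<open>bij f\<close> by (simp add: bij_is_surj surj_f_inv_f)
      then show ?thesis using f by (metis (mono_tags, lifting) mem_Collect_eq)
    qed
    ultimately show "inv\<^bsub>BijGroup UNIV\<^esub> f \<in> ?H"
      by (auto simp: Bij_def bij_imp_bij_inv)
  next
    fix f g assume fg: "f \<in> ?H" "g \<in> ?H"
    then have "bij f" "bij g" by (auto simp: Bij_def)
    then have "bij (f \<circ> g)" by (rule bij_comp[rotated])
    moreover have "(f \<circ> g) ` C = C" unfolding image_comp[symmetric] using fg by simp
    ultimately show "f \<otimes>\<^bsub>BijGroup UNIV\<^esub> g \<in> ?H"
      using fg by (simp add: BijGroup_def Bij_def comp)
  qed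
  then have "group (BijGroup UNIV\<lparr>carrier := ?H\<rparr>)" by (rule B.subgroup_imp_group)
  moreover have "CodeAut C = BijGroup UNIV\<lparr>carrier := ?H\<rparr>"
    by (simp add: CodeAut_def HammingAut_def)
  ultimately show ?thesis by simp
qed

lemma CodeAut_carrier: "carrier (CodeAut C) = {x \<in> carrier HammingAut. x ` C = C}"
  by (simp add: CodeAut_def)

text \<open>
  Automorphisms of a code permute each set of \<open>i\<close>-neighbours, so complete transitivity under the
  full group only requires that two \<open>i\<close>-neighbours can be moved to each other.
\<close>

lemma completely_transitiveI:
  fixes C :: "('q::finite ^ 'm) set"
  assumes ne: "\<And>i. i \<le> covering_radius C \<Longrightarrow> neighbours C i \<noteq> {}"
    and trans: "\<And>i \<alpha> \<beta>. i \<le> covering_radius C \<Longrightarrow> \<alpha> \<in> neighbours C i \<Longrightarrow> \<beta> \<in> neighbours C i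
      \<Longrightarrow> \<exists>x \<in> carrier HammingAut. x ` C = C \<and> x \<alpha> = \<beta>"
  shows "completely_transitive C"
proof -
  have "subgroup (carrier (CodeAut C)) (CodeAut C)"
    by (rule group.subgroup_self[OF group_CodeAut])
  moreover have "\<exists>\<alpha>. neighbours C i = orbit (CodeAut C) (\<lambda>g. g) \<alpha>" if i: "i \<le> covering_radius C" for i
  proof -
    obtain \<alpha> where \<alpha>: "\<alpha> \<in> neighbours C i" using ne[OF i] by blast
    have "neighbours C i = orbit (CodeAut C) (\<lambda>g. g) \<alpha>"
    proof
      show "neighbours C i \<subseteq> orbit (CodeAut C) (\<lambda>g. g) \<alpha>"
        using trans[OF i \<alpha>] by (force simp: orbit_def CodeAut_carrier)
      show "orbit (CodeAut C) (\<lambda>g. g) \<alpha> \<subseteq> neighbours C i"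
        using \<alpha> by (auto simp: orbit_def CodeAut_carrier) (metis neighbours_image imageI)
    qed
    then show ?thesis by blast
  qed
  ultimately show ?thesis
    unfolding completely_transitive_def completely_transitive_wrt_def by fastforce
qed

section \<open>Counting\<close>

text \<open>Every fibre of \<open>f\<close> over its image is a translate of the kernel.\<close>

lemma card_vimage_times_card_image:
  fixes f :: "'a::ab_group_add \<Rightarrow> 'b::ab_group_add"
  assumes "finite A" and diff: "\<And>x y. x \<in> A \<Longrightarrow> y \<in> A \<Longrightarrow> x - y \<in> A"
    and add: "\<And>x y. f (x + y) = f x + f y"
    and "T \<subseteq> f ` A"
  shows "card {x \<in> A. f x \<in> T} * card (f ` A) = card T * card A"
proof -
  have f0: "f 0 = 0" using add[of 0 0] by simp
  have fdiff: "f (x - y) = f x - f y" for x y using add[of "x - y" y] by simp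
  have fibre: "card {x \<in> A. f x = b} = card {x \<in> A. f x = 0}" if "b \<in> f ` A" for b
  proof -
    obtain y where y: "y \<in> A" "b = f y" using \<open>b \<in> f ` A\<close> by blast
    have plus: "x + y \<in> A" if "x \<in> A" for x
      using diff[OF that diff[OF diff[OF y(1) y(1)] y(1)]] by simp
    have "bij_betw (\<lambda>x. x + y) {x \<in> A. f x = 0} {x \<in> A. f x = b}"
      by (rule bij_betw_byWitness[where f' = "\<lambda>x. x - y"])
        (use y diff plus in \<open>auto simp: add fdiff\<close>)
    from bij_betw_same_card[OF this] show ?thesis by simp
  qed
  have count: "card {x \<in> A. f x \<in> U} = card U * card {x \<in> A. f x = 0}" if U: "U \<subseteq> f ` A" for U
  proof -
    have "{x \<in> A. f x \<in> U} = (\<Union>b\<in>U. {x \<in> A. f x = b})" by auto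
    also have "card \<dots> = (\<Sum>b\<in>U. card {x \<in> A. f x = b})"
      by (rule card_UN_disjoint)
        (use U \<open>finite A\<close> in \<open>auto intro: finite_subset[OF U]\<close>)
    also have "\<dots> = (\<Sum>b\<in>U. card {x \<in> A. f x = 0})"
      by (rule sum.cong[OF refl fibre]) (use U in blast)
    finally show ?thesis by simp
  qed
  have "{x \<in> A. f x \<in> f ` A} = A" by auto
  then show ?thesis using count[OF assms(4)] count[OF subset_refl] by simp
qed

lemma card_subspace:
  fixes S :: "('q::{field,finite} ^ 'm) set"
  assumes "vec.subspace S"
  shows "card S = CARD('q) ^ vec.dim S"
proof -
  obtain B where B: "B \<subseteq> S" "vec.independent B" "S \<subseteq> vec.span B" "card B = vec.dim S"
    by (rule vec.basis_exists)
  have fin: "finite B" by simp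
  let ?F = "B \<rightarrow>\<^sub>E (UNIV :: 'q set)"
  let ?h = "\<lambda>f. \<Sum>b\<in>B. f b *s b"
  have "vec.span B = S"
    using B assms by (simp add: vec.span_minimal subset_antisym)
  have "bij_betw ?h ?F S"
  proof (rule bij_betwI')
    fix f g assume fg: "f \<in> ?F" "g \<in> ?F"
    show "?h f = ?h g \<longleftrightarrow> f = g"
    proof
      assume eq: "?h f = ?h g"
      have "(\<Sum>b\<in>B. (f b - g b) *s b) = 0"
        using eq by (simp add: vec.scale_left_diff_distrib sum_subtractf)
      then have "f b - g b = 0" if "b \<in> B" for b
        using vec.independentD[OF B(2) fin subset_refl _ that, of "\<lambda>b. f b - g b"] by blast
      then show "f = g" using fg by (intro PiE_ext[OF fg]) simp
    qed simp
  next
    fix f assume "f \<in> ?F"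
    show "?h f \<in> S" using B(1) assms by (auto intro!: vec.subspace_sum vec.subspace_scale)
  next
    fix y assume "y \<in> S"
    then obtain u where "y = (\<Sum>b\<in>B. u b *s b)"
      using \<open>vec.span B = S\<close> vec.span_finite[OF fin] by auto
    then have "y = ?h (restrict u B)" by (simp cong: sum.cong)
    then show "\<exists>f\<in>?F. y = ?h f" by (intro bexI[of _ "restrict u B"]) auto
  qed
  from bij_betw_same_card[OF this] have "card S = card ?F" by simp
  also have "\<dots> = CARD('q) ^ card B" by (simp add: card_PiE fin)
  finally show ?thesis using B(4) by simp
qed

lemma dim_subspace_eqI:
  fixes S :: "('q::{field,finite} ^ 'm) set"
  assumes "vec.subspace S" "card S = CARD('q) ^ k"
  shows "vec.dim S = k"
proof -
  have "card {0, 1 :: 'q} \<le> CARD('q)" by (rule card_mono) auto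
  then show ?thesis using card_subspace[OF assms(1)] assms(2) by simp
qed

lemma CARD_bit: "CARD(bit) = 2"
proof -
  have "(UNIV :: bit set) = {0, 1}" by (auto intro: bit.exhaust)
  then show ?thesis by (metis card_2_iff zero_neq_one)
qed

section \<open>Binary words and sphere packing\<close>

lemma bit_add_eq_0_iff: "a + b = 0 \<longleftrightarrow> a = (b :: bit)"
  by (cases a; cases b) simp_all

lemma bij_support: "bij (\<lambda>x :: bit ^ 'm. {i. x $ i \<noteq> 0})"
proof (rule bij_betw_byWitness[where f' = "\<lambda>X. \<chi> i. of_bool (i \<in> X)"])
  show "\<forall>x\<in>UNIV. (\<chi> i. of_bool (i \<in> {i. x $ i \<noteq> 0})) = (x :: bit ^ 'm)"
    by (simp add: vec_eq_iff of_bool_def)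
qed auto

lemma bit_vec_add_self [simp]: "x + x = (0 :: bit ^ 'm)"
  by (simp add: vec_eq_iff)

lemma bit_vec_add_add_self [simp]: "x + y + y = (x :: bit ^ 'm)" "y + (y + x) = x"
  unfolding add.assoc bit_vec_add_self add_0_right add.assoc[symmetric] add_0_left by simp_all

lemma bit_vec_diff: "x - y = x + (y :: bit ^ 'm)"
  by (simp add: vec_eq_iff)

lemma card_sphere: "card {y :: bit ^ 'm. hamming_dist x y = r} = CARD('m) choose r"
proof -
  let ?f = "\<lambda>y :: bit ^ 'm. {i. (y + x) $ i \<noteq> 0}"
  have "bij (\<lambda>y. y + x)"
    by (rule bij_betw_byWitness[where f' = "\<lambda>y. y + x"]) auto
  then have "bij ((\<lambda>y :: bit ^ 'm. {i. y $ i \<noteq> 0}) \<circ> (\<lambda>y. y + x))"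
    using bij_support by (rule bij_comp)
  then have f: "bij ?f" by (simp add: comp_def)
  have dist: "hamming_dist x y = card (?f y)" for y
  proof -
    have "x $ i \<noteq> y $ i \<longleftrightarrow> (y + x) $ i \<noteq> 0" for i
      by (cases "x $ i"; cases "y $ i") simp_all
    then show ?thesis by (simp only: hamming_dist_def)
  qed
  have "?f ` {y. hamming_dist x y = r} = {X. X \<subseteq> UNIV \<and> card X = r}"
  proof -
    have "X \<in> ?f ` {y. card (?f y) = r}" if "card X = r" for X
    proof -
      obtain y where "X = ?f y" using f by (rule bij_pointE) blast
      then show ?thesis using that by blast
    qed
    then show ?thesis unfolding dist by blast
  qed
  moreover have "inj_on ?f {y. hamming_dist x y = r}"
    by (rule inj_on_subset[OF bij_is_inj[OF f]]) simp
  ultimately have "card {y. hamming_dist x y = r} = card {X :: 'm set. X \<subseteq> UNIV \<and> card X = r}"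
    using card_image[of ?f "{y. hamming_dist x y = r}"] by simp
  then show ?thesis by (simp only: n_subsets[OF finite])
qed

text \<open>Spheres of radius at most \<open>e\<close> around different codewords do not meet.\<close>

lemma card_union_spheres:
  fixes C :: "(bit ^ 'm) set"
  assumes sep: "\<And>\<alpha> \<beta>. \<alpha> \<in> C \<Longrightarrow> \<beta> \<in> C \<Longrightarrow> \<alpha> \<noteq> \<beta> \<Longrightarrow> 2 * e < hamming_dist \<alpha> \<beta>"
    and R: "finite R" "\<And>r. r \<in> R \<Longrightarrow> r \<le> e"
  shows "card {y. \<exists>\<alpha>\<in>C. hamming_dist \<alpha> y \<in> R} = card C * (\<Sum>r\<in>R. CARD('m) choose r)"
proof -
  have ball: "card {y :: bit ^ 'm. hamming_dist \<alpha> y \<in> R} = (\<Sum>r\<in>R. CARD('m) choose r)" for \<alpha>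
  proof -
    have "{y. hamming_dist \<alpha> y \<in> R} = (\<Union>r\<in>R. {y. hamming_dist \<alpha> y = r})" by auto
    then show ?thesis
      using R(1) by (simp add: card_UN_disjoint card_sphere disjoint_iff)
  qed
  have "{y. \<exists>\<alpha>\<in>C. hamming_dist \<alpha> y \<in> R} = (\<Union>\<alpha>\<in>C. {y. hamming_dist \<alpha> y \<in> R})" by auto
  also have "card \<dots> = (\<Sum>\<alpha>\<in>C. card {y. hamming_dist \<alpha> y \<in> R})"
  proof (rule card_UN_disjoint)
    have "hamming_dist \<beta> y \<notin> R" if "\<alpha> \<in> C" "\<beta> \<in> C" "\<alpha> \<noteq> \<beta>" "hamming_dist \<alpha> y \<in> R" for \<alpha> \<beta> y
      using sep[OF that(1-3)] R(2)[OF that(4)] R(2)[of "hamming_dist \<beta> y"]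
        hamming_dist_triangle[of \<alpha> \<beta> y] hamming_dist_commute[of y \<beta>] by force
    then show "\<forall>\<alpha>\<in>C. \<forall>\<beta>\<in>C. \<alpha> \<noteq> \<beta> \<longrightarrow> {y. hamming_dist \<alpha> y \<in> R} \<inter> {y. hamming_dist \<beta> y \<in> R} = {}"
      by blast
  qed auto
  finally show ?thesis by (simp add: ball)
qed

section \<open>Reed-Muller codes\<close>

definition coord_sum :: "'q::{field,finite} ^ ('q ^ 'd) \<Rightarrow> 'q" where
  "coord_sum \<alpha> = (\<Sum>v\<in>UNIV. \<alpha> $ v)"

definition moment :: "'q::{field,finite} ^ ('q ^ 'd) \<Rightarrow> 'q ^ 'd" where
  "moment \<alpha> = (\<Sum>v\<in>UNIV. \<alpha> $ v *s v)"

lemma reed_muller_iff: "\<alpha> \<in> reed_muller \<longleftrightarrow> coord_sum \<alpha> = 0 \<and> moment \<alpha> = 0"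
  by (simp add: reed_muller_def coord_sum_def moment_def)

lemma coord_sum_add [simp]: "coord_sum (\<alpha> + \<beta>) = coord_sum \<alpha> + coord_sum \<beta>"
  by (simp add: coord_sum_def sum.distrib)

lemma moment_add [simp]: "moment (\<alpha> + \<beta>) = moment \<alpha> + moment \<beta>"
  by (simp add: moment_def sum.distrib vec.scale_left_distrib)

lemma coord_sum_scale [simp]: "coord_sum (c *s \<alpha>) = c * coord_sum \<alpha>"
  by (simp add: coord_sum_def sum_distrib_left)

lemma moment_scale [simp]: "moment (c *s \<alpha>) = c *s moment \<alpha>"
  by (simp add: moment_def vec.scale_sum_right)

lemma coord_sum_0 [simp]: "coord_sum 0 = 0"
  by (simp add: coord_sum_def)

lemma moment_0 [simp]: "moment 0 = 0"
  by (simp add: moment_def)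

lemma coord_sum_diff [simp]: "coord_sum (\<alpha> - \<beta>) = coord_sum \<alpha> - coord_sum \<beta>"
  by (simp add: coord_sum_def sum_subtractf)

lemma moment_diff [simp]: "moment (\<alpha> - \<beta>) = moment \<alpha> - moment \<beta>"
  by (simp add: moment_def sum_subtractf vec.scale_left_diff_distrib)

lemma coord_sum_axis [simp]: "coord_sum (axis v c) = c"
  by (simp add: coord_sum_def axis_def)

lemma moment_axis [simp]: "moment (axis v c) = c *s v"
proof -
  have "moment (axis v c) = (\<Sum>w\<in>UNIV. if w = v then c *s w else 0)"
    unfolding moment_def by (rule sum.cong) (auto simp: axis_def)
  then show ?thesis by simp
qed

lemma subspace_reed_muller: "vec.subspace reed_muller"
  by (rule vec.subspaceI) (auto simp: reed_muller_iff)

lemma dim_reed_muller: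
  "vec.dim (reed_muller :: ('q::{field,finite} ^ ('q ^ 'd)) set) = CARD('q) ^ CARD('d) - CARD('d) - 1"
proof -
  let ?C = "reed_muller :: ('q ^ ('q ^ 'd)) set"
  let ?f = "\<lambda>\<alpha> :: 'q ^ ('q ^ 'd). (coord_sum \<alpha>, moment \<alpha>)"
  let ?q = "CARD('q)"
  have "surj ?f"
  proof (rule surjI)
    fix p :: "'q \<times> ('q ^ 'd)"
    let ?\<alpha> = "axis (snd p) 1 + axis 0 (fst p - 1) :: 'q ^ ('q ^ 'd)"
    show "?f ?\<alpha> = p" by simp
  qed
  then have "card (range ?f) = ?q ^ (CARD('d) + 1)"
    by (simp add: CARD_vec)
  moreover have "card {\<alpha> \<in> UNIV. ?f \<alpha> \<in> {0}} * card (range ?f) = card {0 :: 'q \<times> ('q ^ 'd)} * CARD('q ^ ('q ^ 'd))"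
    by (rule card_vimage_times_card_image) (use \<open>surj ?f\<close> in auto)
  moreover have "card ?C = ?q ^ vec.dim ?C"
    by (rule card_subspace[OF subspace_reed_muller])
  moreover have "{\<alpha> \<in> UNIV. ?f \<alpha> \<in> {0}} = ?C"
    by (auto simp: reed_muller_iff zero_prod_def)
  ultimately have "?q ^ (vec.dim ?C + (CARD('d) + 1)) = ?q ^ (?q ^ CARD('d))"
    by (simp add: CARD_vec power_add mult_ac)
  moreover have "card {0, 1 :: 'q} \<le> ?q" by (rule card_mono) auto
  ultimately have "vec.dim ?C + (CARD('d) + 1) = ?q ^ CARD('d)"
    using power_inject_exp[of ?q "vec.dim ?C + (CARD('d) + 1)" "?q ^ CARD('d)"] by simp
  then show ?thesis by simp
qed

text \<open>
  Scaling the entries, moving the coordinates by an affine bijection and adding a codeword are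
  automorphisms of the code that act on the pair of \<open>coord_sum\<close> and \<open>moment\<close>. Since adding
  codewords identifies all words with the same pair, transitivity on neighbours becomes
  transitivity on pairs.
\<close>

lemma affine_moves_neighbour:
  fixes \<alpha> \<beta> :: "'q::{field,finite} ^ ('q ^ 'd)"
  assumes c: "c \<noteq> 0" and f: "bij f" "\<And>v. f v = L v + u"
    and L: "\<And>x y. L (x + y) = L x + L y" "\<And>c x. L (c *s x) = c *s L x"
    and sum: "coord_sum \<beta> = c * coord_sum \<alpha>"
    and mom: "moment \<beta> = c *s (L (moment \<alpha>) + coord_sum \<alpha> *s u)"
  shows "\<exists>x \<in> carrier HammingAut. x ` reed_muller = reed_muller \<and> x \<alpha> = \<beta>"
proof -
  define y where "y \<gamma> = (\<chi> v. c * \<gamma> $ inv_into UNIV f v)" for \<gamma> :: "'q ^ ('q ^ 'd)"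
  have bij_inv: "bij (inv_into UNIV f)" using f(1) by (rule bij_imp_bij_inv)
  have inv_f: "inv_into UNIV f (f v) = v" for v using f(1) by (simp add: bij_is_inj)
  have f_inv: "f (inv_into UNIV f v) = v" for v
    using f(1) by (simp add: bij_is_surj surj_f_inv_f)
  have L_sum: "L (\<Sum>v\<in>S. g v) = (\<Sum>v\<in>S. L (g v))" if "finite S" for g and S :: "('q ^ 'd) set"
    using that
  proof induction
    case empty
    show ?case using L(1)[of 0 0] by simp
  qed (simp add: L(1))
  have sum_y: "coord_sum (y \<gamma>) = c * coord_sum \<gamma>" for \<gamma>
    unfolding coord_sum_def y_def vec_lambda_beta sum_distrib_left[symmetric]
    by (subst sum.reindex_bij_betw[OF bij_inv, of "\<lambda>v. \<gamma> $ v"]) simp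
  have mom_y: "moment (y \<gamma>) = c *s (L (moment \<gamma>) + coord_sum \<gamma> *s u)" for \<gamma>
  proof -
    have "moment (y \<gamma>) = (\<Sum>v\<in>UNIV. y \<gamma> $ f v *s f v)"
      unfolding moment_def by (rule sum.reindex_bij_betw[OF f(1), symmetric])
    also have "\<dots> = (\<Sum>v\<in>UNIV. c *s (\<gamma> $ v *s (L v + u)))"
      by (rule sum.cong) (simp_all add: y_def inv_f f(2)[symmetric])
    also have "\<dots> = c *s ((\<Sum>v\<in>UNIV. \<gamma> $ v *s L v) + (\<Sum>v\<in>UNIV. \<gamma> $ v *s u))"
      unfolding vec.scale_sum_right[symmetric] vec.scale_right_distrib sum.distrib by (rule refl)
    finally show ?thesis
      by (simp add: moment_def coord_sum_def L_sum L(2) vec.scale_sum_left)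
  qed
  define x where "x \<gamma> = y \<gamma> + (\<beta> - y \<alpha>)" for \<gamma>
  have dist: "hamming_dist (x \<gamma>) (x \<delta>) = hamming_dist \<gamma> \<delta>" for \<gamma> \<delta>
  proof -
    have "bij_betw f {v. \<gamma> $ v \<noteq> \<delta> $ v} {v. y \<gamma> $ v \<noteq> y \<delta> $ v}"
      by (rule bij_betw_byWitness[where f' = "inv_into UNIV f"])
        (use c in \<open>auto simp: y_def inv_f f_inv\<close>)
    from bij_betw_same_card[OF this] show ?thesis
      unfolding x_def hamming_dist_add by (simp add: hamming_dist_def)
  qed
  then have inj: "inj x" by (intro injI) (metis hamming_dist_eq_0_iff)
  then have "bij x" by (simp add: bij_def finite_UNIV_inj_surj)
  then have "x \<in> carrier HammingAut" using dist by (rule HammingAutI)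
  moreover have "x ` reed_muller = reed_muller"
  proof (rule endo_inj_surj)
    have L0: "L 0 = 0" using L(1)[of 0 0] by simp
    show "x ` reed_muller \<subseteq> reed_muller"
      using sum mom by (auto simp: reed_muller_iff x_def sum_y mom_y L0)
    show "inj_on x reed_muller" using inj by (rule inj_on_subset) simp
  qed simp
  moreover have "x \<alpha> = \<beta>" by (simp add: x_def)
  ultimately show ?thesis by blast
qed

text \<open>
  The linear bijection is \<open>v + \<phi> v *s (w' - w)\<close> for a linear form \<open>\<phi>\<close> with \<open>\<phi> w = 1\<close>; it is
  injective because \<open>1 + \<phi> (w' - w) = \<phi> w'\<close> is nonzero. Such a form is a multiple of a coordinate
  at which both vectors are nonzero, or else a combination of two coordinates.
\<close>

lemma linear_bij_transitive:
  fixes w w' :: "'q::{field,finite} ^ 'd"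
  assumes "w \<noteq> 0" "w' \<noteq> 0"
  obtains L where "bij L" "L w = w'" "\<And>x y. L (x + y) = L x + L y" "\<And>c x. L (c *s x) = c *s L x"
proof -
  have "\<exists>\<phi>. \<phi> w = 1 \<and> \<phi> w' \<noteq> 0 \<and> (\<forall>x y. \<phi> (x + y) = \<phi> x + \<phi> y) \<and> (\<forall>c x. \<phi> (c *s x) = c * \<phi> x)"
  proof (cases "\<exists>i. w $ i \<noteq> 0 \<and> w' $ i \<noteq> 0")
    case True
    then obtain i where "w $ i \<noteq> 0" "w' $ i \<noteq> 0" by blast
    then show ?thesis by (intro exI[of _ "\<lambda>x. x $ i / w $ i"]) (simp add: add_divide_distrib)
  next
    case False
    obtain i j where ij: "w $ i \<noteq> 0" "w' $ j \<noteq> 0" using assms by (auto simp: vec_eq_iff)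
    then have "w' $ i = 0" "w $ j = 0" using False by blast+
    with ij show ?thesis
      by (intro exI[of _ "\<lambda>x. x $ i / w $ i + x $ j"]) (simp add: add_divide_distrib algebra_simps)
  qed
  then obtain \<phi> where \<phi>: "\<phi> w = 1" "\<phi> w' \<noteq> 0" "\<And>x y. \<phi> (x + y) = \<phi> x + \<phi> y"
      "\<And>c x. \<phi> (c *s x) = c * \<phi> x" by blast
  define L where "L x = x + \<phi> x *s (w' - w)" for x
  have \<phi>_diff: "\<phi> (x - y) = \<phi> x - \<phi> y" for x y using \<phi>(3)[of "x - y" y] by simp
  have "inj L"
  proof (rule injI)
    fix x y assume "L x = L y"
    then have xy: "x - y = - (\<phi> (x - y) *s (w' - w))"
      by (simp add: L_def \<phi>_diff vec.scale_left_diff_distrib algebra_simps)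
    have "\<phi> (- z) = - \<phi> z" for z using \<phi>_diff[of 0 z] \<phi>_diff[of 0 0] by simp
    then have "\<phi> (x - y) = - (\<phi> (x - y) * (\<phi> w' - 1))"
      by (metis xy \<phi>(1,4) \<phi>_diff)
    then have "\<phi> (x - y) * \<phi> w' = 0" by (simp add: algebra_simps)
    then have "\<phi> (x - y) = 0" using \<phi>(2) by simp
    then show "x = y" using xy by simp
  qed
  then have "bij L" by (simp add: bij_def finite_UNIV_inj_surj)
  moreover have "L w = w'" by (simp add: L_def \<phi>(1))
  moreover have "L (x + y) = L x + L y" for x y
    by (simp add: L_def \<phi>(3) vec.scale_left_distrib)
  moreover have "L (c *s x) = c *s L x" for c x
    by (simp add: L_def \<phi>(4) vec.scale_right_distrib)
  ultimately show thesis using that by blast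
qed

lemma reed_muller_nonempty [simp]: "reed_muller \<noteq> {}"
  using vec.subspace_0[OF subspace_reed_muller] by blast

text \<open>
  A single change of an entry by \<open>c\<close> at \<open>v\<close> changes the pair of \<open>coord_sum\<close> and \<open>moment\<close> by
  \<open>(c, c *s v)\<close>, which can be any pair with nonzero first component. A nonzero pair with first
  component zero takes two changes, of opposite sign.
\<close>

lemma dist_reed_muller_1:
  assumes "coord_sum \<alpha> \<noteq> 0"
  shows "dist_to_code \<alpha> reed_muller = 1"
proof -
  let ?\<eta> = "axis (inverse (coord_sum \<alpha>) *s moment \<alpha>) (coord_sum \<alpha>)"
  have "\<alpha> - ?\<eta> \<in> reed_muller" using assms by (simp add: reed_muller_iff)
  moreover have "hamming_dist \<alpha> (\<alpha> - ?\<eta>) = 1"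
    using assms hamming_dist_add_self[of "\<alpha> - ?\<eta>" ?\<eta>] by (simp add: hamming_dist_axis)
  moreover have "1 \<le> hamming_dist \<alpha> \<beta>" if "\<beta> \<in> reed_muller" for \<beta>
    using that assms hamming_dist_eq_0_iff[of \<alpha> \<beta>] by (cases "\<alpha> = \<beta>") (auto simp: reed_muller_iff)
  ultimately show ?thesis by (subst dist_to_code_eq_iff) auto
qed

lemma dist_reed_muller_2:
  fixes \<alpha> :: "'q::{field,finite} ^ ('q ^ 'd)"
  assumes "coord_sum \<alpha> = 0" "moment \<alpha> \<noteq> 0"
  shows "dist_to_code \<alpha> reed_muller = 2"
proof -
  let ?\<eta> = "axis (moment \<alpha>) 1 - axis 0 1 :: 'q ^ ('q ^ 'd)"
  have "\<alpha> - ?\<eta> \<in> reed_muller" using assms by (simp add: reed_muller_iff)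
  moreover have "hamming_dist \<alpha> (\<alpha> - ?\<eta>) = 2"
  proof -
    have "{v. ?\<eta> $ v \<noteq> 0} = {moment \<alpha>, 0}" using assms by (auto simp: axis_def)
    then show ?thesis
      using assms hamming_dist_add_self[of "\<alpha> - ?\<eta>" ?\<eta>] by (simp add: hamming_dist_def)
  qed
  moreover have "2 \<le> hamming_dist \<alpha> \<beta>" if \<beta>: "\<beta> \<in> reed_muller" for \<beta>
  proof (rule ccontr)
    assume "\<not> 2 \<le> hamming_dist \<alpha> \<beta>"
    then consider "hamming_dist \<alpha> \<beta> = 0" | "hamming_dist \<alpha> \<beta> = 1" by linarith
    then show False
    proof cases
      case 1
      then show False using assms \<beta> by (simp add: hamming_dist_eq_0_iff reed_muller_iff)
    next
      case 2
      then obtain v c where "c \<noteq> 0" "\<alpha> = \<beta> + axis v c" by (rule hamming_dist_one_axis)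
      then show False using assms \<beta> by (simp add: reed_muller_iff)
    qed
  qed
  ultimately show ?thesis by (subst dist_to_code_eq_iff) auto
qed

lemma dist_reed_muller_0:
  assumes "\<alpha> \<in> reed_muller"
  shows "dist_to_code \<alpha> reed_muller = 0"
  using assms neighbours_0[OF reed_muller_nonempty] by (auto simp: neighbours_def)

lemma neighbours_reed_muller:
  "neighbours reed_muller 1 = {\<alpha> :: 'q::{field,finite} ^ ('q ^ 'd). coord_sum \<alpha> \<noteq> 0}"
  "neighbours reed_muller 2 = {\<alpha> :: 'q ^ ('q ^ 'd). coord_sum \<alpha> = 0 \<and> moment \<alpha> \<noteq> 0}"
proof -
  have "dist_to_code \<alpha> reed_muller = (if coord_sum \<alpha> \<noteq> 0 then 1 else if moment \<alpha> \<noteq> 0 then 2 else 0)"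
    for \<alpha> :: "'q ^ ('q ^ 'd)"
    by (simp add: dist_reed_muller_0 dist_reed_muller_1 dist_reed_muller_2 reed_muller_iff)
  then show "neighbours reed_muller 1 = {\<alpha> :: 'q ^ ('q ^ 'd). coord_sum \<alpha> \<noteq> 0}"
    and "neighbours reed_muller 2 = {\<alpha> :: 'q ^ ('q ^ 'd). coord_sum \<alpha> = 0 \<and> moment \<alpha> \<noteq> 0}"
    by (auto simp: neighbours_def)
qed

lemma covering_radius_reed_muller:
  "covering_radius (reed_muller :: ('q::{field,finite} ^ ('q ^ 'd)) set) \<le> 2"
proof (rule covering_radius_le)
  show "dist_to_code \<alpha> reed_muller \<le> 2" for \<alpha> :: "'q ^ ('q ^ 'd)"
    by (cases "coord_sum \<alpha> = 0"; cases "moment \<alpha> = 0")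
      (simp_all add: dist_reed_muller_0 dist_reed_muller_1 dist_reed_muller_2 reed_muller_iff)
qed

lemma completely_transitive_reed_muller:
  "completely_transitive (reed_muller :: ('q::{field,finite} ^ ('q ^ 'd)) set)"
proof (rule completely_transitiveI)
  let ?C = "reed_muller :: ('q ^ ('q ^ 'd)) set"
  fix i assume "i \<le> covering_radius ?C"
  then have "i \<le> 2" using covering_radius_reed_muller le_trans by blast
  then have i: "i = 0 \<or> i = 1 \<or> i = 2" by linarith
  have "(axis 0 1 :: 'q ^ ('q ^ 'd)) \<in> neighbours ?C 1"
    unfolding neighbours_reed_muller by simp
  moreover have "(axis (axis undefined 1) 1 - axis 0 1 :: 'q ^ ('q ^ 'd)) \<in> neighbours ?C 2"
    by (simp add: neighbours_reed_muller axis_eq_0_iff)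
  ultimately show "neighbours ?C i \<noteq> {}" using i neighbours_0[of ?C] reed_muller_nonempty by (metis empty_iff)
next
  let ?C = "reed_muller :: ('q ^ ('q ^ 'd)) set"
  fix i and \<alpha> \<beta> :: "'q ^ ('q ^ 'd)"
  assume "i \<le> covering_radius ?C" and \<alpha>: "\<alpha> \<in> neighbours ?C i" and \<beta>: "\<beta> \<in> neighbours ?C i"
  then have "i \<le> 2" using covering_radius_reed_muller le_trans by blast
  then consider "i = 0" | "i = 1" | "i = 2" by linarith
  then show "\<exists>x \<in> carrier HammingAut. x ` ?C = ?C \<and> x \<alpha> = \<beta>"
  proof cases
    case 1
    then have "\<alpha> \<in> ?C" "\<beta> \<in> ?C" using \<alpha> \<beta> by (simp_all add: neighbours_0)
    then show ?thesis
      by (intro affine_moves_neighbour[of 1 id "\<lambda>v. v" 0]) (simp_all add: reed_muller_iff)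
  next
    case 2
    then have sum: "coord_sum \<alpha> \<noteq> 0" "coord_sum \<beta> \<noteq> 0"
      using \<alpha> \<beta> unfolding 2 neighbours_reed_muller by simp_all
    let ?c = "coord_sum \<beta> / coord_sum \<alpha>"
    let ?u = "inverse (coord_sum \<alpha>) *s (inverse ?c *s moment \<beta> - moment \<alpha>)"
    show ?thesis
    proof (rule affine_moves_neighbour[of ?c "\<lambda>v. v + ?u" "\<lambda>v. v" ?u])
      show "bij (\<lambda>v. v + ?u)"
        by (rule bij_betw_byWitness[where f' = "\<lambda>v. v - ?u"]) auto
      show "moment \<beta> = ?c *s (moment \<alpha> + coord_sum \<alpha> *s ?u)" using sum by simp
    qed (use sum in auto)
  next
    case 3
    then have syn: "coord_sum \<alpha> = 0" "coord_sum \<beta> = 0" "moment \<alpha> \<noteq> 0" "moment \<beta> \<noteq> 0"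
      using \<alpha> \<beta> by (simp_all add: neighbours_reed_muller)
    obtain L where L: "bij L" "L (moment \<alpha>) = moment \<beta>" "\<And>x y. L (x + y) = L x + L y"
        "\<And>c x. L (c *s x) = c *s L x"
      using linear_bij_transitive[OF syn(3,4)] by blast
    show ?thesis
      by (rule affine_moves_neighbour[of 1 L L 0]) (use L syn in auto)
  qed
qed

text \<open>
  Being a 1-neighbour only depends on \<open>coord_sum\<close>, so a translation that changes just the
  \<open>moment\<close> moves the code but not the set of its 1-neighbours.
\<close>

lemma elusive_reed_muller: "elusive 1 (reed_muller :: ('q::{field,finite} ^ ('q ^ 'd)) set)"
proof -
  let ?C = "reed_muller :: ('q ^ ('q ^ 'd)) set"
  define \<eta> :: "'q ^ ('q ^ 'd)" where "\<eta> = axis (axis undefined 1) 1 - axis 0 1"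
  have \<eta>: "coord_sum \<eta> = 0" "moment \<eta> \<noteq> 0" by (simp_all add: \<eta>_def axis_eq_0_iff)
  show ?thesis
  proof (rule elusive_translateI)
    have "(axis 0 1 :: 'q ^ ('q ^ 'd)) \<in> neighbours ?C 1"
      unfolding neighbours_reed_muller by simp
    then show "neighbours ?C 1 \<noteq> {}" by blast
    have "0 + \<eta> \<in> (\<lambda>\<alpha>. \<alpha> + \<eta>) ` ?C" by (rule imageI) (simp add: reed_muller_iff)
    moreover have "0 + \<eta> \<notin> ?C" using \<eta> by (simp add: reed_muller_iff)
    ultimately show "(\<lambda>\<alpha>. \<alpha> + \<eta>) ` ?C \<noteq> ?C" by metis
    show "(\<lambda>\<alpha>. \<alpha> + \<eta>) ` neighbours ?C 1 = neighbours ?C 1"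
    proof (rule endo_inj_surj)
      show "(\<lambda>\<alpha>. \<alpha> + \<eta>) ` neighbours ?C 1 \<subseteq> neighbours ?C 1"
        using \<eta>(1) unfolding neighbours_reed_muller by auto
    qed auto
  qed simp
qed

text \<open>
  Clearing one nonzero entry of a codeword, at position \<open>v\<close>, leaves a word whose two invariants are
  those of a single entry at \<open>v\<close>, up to sign. A word with just one nonzero entry determines its
  position by its invariants, so it would have this entry at \<open>v\<close> as well, which was cleared.
\<close>

lemma min_distance_reed_muller_ge:
  fixes \<gamma> :: "'q::{field,finite} ^ ('q ^ 'd)"
  assumes \<gamma>: "\<gamma> \<in> reed_muller" "\<gamma> \<noteq> 0"
  shows "3 \<le> hamming_dist \<gamma> 0"
proof -
  obtain v where v: "\<gamma> $ v \<noteq> 0" using \<gamma>(2) by (auto simp: vec_eq_iff)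
  let ?\<alpha> = "\<gamma> - axis v (\<gamma> $ v)"
  have dist: "hamming_dist \<gamma> 0 = Suc (hamming_dist ?\<alpha> 0)"
  proof -
    have "{i. \<gamma> $ i \<noteq> 0} = insert v {i. ?\<alpha> $ i \<noteq> 0}" "v \<notin> {i. ?\<alpha> $ i \<noteq> 0}"
      using v by (auto simp: axis_def)
    then show ?thesis by (simp add: hamming_dist_def)
  qed
  have syn: "coord_sum ?\<alpha> = - (\<gamma> $ v)" "moment ?\<alpha> = - (\<gamma> $ v *s v)"
    using \<gamma>(1) by (simp_all add: reed_muller_iff)
  have "hamming_dist ?\<alpha> 0 \<noteq> 0"
    using syn v by (auto simp: hamming_dist_eq_0_iff simp del: coord_sum_diff moment_diff)
  moreover have "hamming_dist ?\<alpha> 0 \<noteq> 1"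
  proof
    assume "hamming_dist ?\<alpha> 0 = 1"
    then obtain w c where wc: "c \<noteq> 0" "?\<alpha> = 0 + axis w c" by (rule hamming_dist_one_axis)
    then have "c = - (\<gamma> $ v)" "c *s w = - (\<gamma> $ v *s v)"
      using syn by (simp_all del: coord_sum_diff moment_diff)
    then have "\<gamma> $ v *s w = \<gamma> $ v *s v" by simp
    then have "w = v" using v by simp
    then have "?\<alpha> $ v = c" using wc(2) by simp
    then show False using wc(1) by simp
  qed
  ultimately show ?thesis using dist by simp
qed

text \<open>
  Over fields with more than two elements three points of an affine line carry a codeword of
  weight 3. Over the two-element field lines have only two points, and the four points of an affine
  plane carry a codeword of weight 4.
\<close>

lemma min_distance_reed_muller:
  assumes "CARD('q) = 2 \<longrightarrow> CARD('d) \<ge> 2"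
  shows "min_distance (reed_muller :: ('q::{field,finite} ^ ('q ^ 'd)) set)
    = (if CARD('q) = 2 then 4 else 3)"
proof (cases "CARD('q) = 2")
  case False
  have "card {0, 1 :: 'q} \<le> CARD('q)" by (rule card_mono) auto
  then have "card (UNIV - {0, 1 :: 'q}) \<noteq> 0" using False by (simp add: card_Diff_subset)
  then have "UNIV - {0, 1 :: 'q} \<noteq> {}" by (metis card.empty)
  then obtain c :: 'q where c: "c \<noteq> 0" "c \<noteq> 1" by blast
  define w :: "'q ^ 'd" where "w = axis undefined 1"
  have w: "w \<noteq> 0" "c *s w \<noteq> 0" "c *s w \<noteq> w"
    using c by (simp_all add: w_def vec_eq_iff axis_def)
  let ?\<gamma> = "axis (c *s w) 1 + axis w (- c) + axis 0 (c - 1) :: 'q ^ ('q ^ 'd)"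
  have supp: "{v. ?\<gamma> $ v \<noteq> 0} = {c *s w, w, 0}" using c w by (auto simp: axis_def)
  have "min_distance (reed_muller :: ('q ^ ('q ^ 'd)) set) = 3"
  proof (rule min_distance_subspace_eqI[OF subspace_reed_muller])
    show "?\<gamma> \<in> reed_muller" by (simp add: reed_muller_iff)
    show "hamming_dist ?\<gamma> 0 = 3" using w supp by (simp add: hamming_dist_def)
    then show "?\<gamma> \<noteq> 0" by (metis hamming_dist_self zero_neq_numeral)
  qed (rule min_distance_reed_muller_ge)
  then show ?thesis using False by simp
next
  case True
  have bin: "x = 0 \<or> x = 1" for x :: 'q
  proof -
    have "{0, 1 :: 'q} = UNIV" by (rule card_subset_eq) (use True in auto)
    then show ?thesis by auto
  qed
  have two: "1 + 1 = (0 :: 'q)" using bin[of "1 + 1"] add_left_cancel[of 1 1 "0 :: 'q"] by (metis add_0_right zero_neq_one)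
  have "1 < card (UNIV :: 'd set)" using True assms by simp
  then obtain i j :: 'd where "i \<noteq> j" by (metis card_le_Suc0_iff_eq finite not_le One_nat_def UNIV_I)
  define a b :: "'q ^ 'd" where "a = axis i 1" and "b = axis j 1"
  have ab: "a \<noteq> 0" "b \<noteq> 0" "a \<noteq> b" "a + b \<noteq> 0" "a + b \<noteq> a" "a + b \<noteq> b"
    using \<open>i \<noteq> j\<close> by (auto simp: a_def b_def axis_eq_0_iff axis_eq_axis vec_eq_iff axis_def split: if_splits)
  let ?\<gamma> = "axis (a + b) 1 + axis a 1 + axis b 1 + axis 0 1 :: 'q ^ ('q ^ 'd)"
  have supp: "{v. ?\<gamma> $ v \<noteq> 0} = {a + b, a, b, 0}" using ab by (auto simp: axis_def)
  have "min_distance (reed_muller :: ('q ^ ('q ^ 'd)) set) = 4"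
  proof (rule min_distance_subspace_eqI[OF subspace_reed_muller])
    have "a + a = 0" "b + b = 0"
      using two vec.scale_left_distrib[of 1 1 a] vec.scale_left_distrib[of 1 1 b] by simp_all
    then have "a + b + a + b = 0" by (simp add: algebra_simps)
    then show "?\<gamma> \<in> reed_muller" using two by (simp add: reed_muller_iff)
    show "hamming_dist ?\<gamma> 0 = 4" using ab supp by (simp add: hamming_dist_def)
    then show "?\<gamma> \<noteq> 0" by (metis hamming_dist_self zero_neq_numeral)
    fix \<delta> :: "'q ^ ('q ^ 'd)" assume \<delta>: "\<delta> \<in> reed_muller" "\<delta> \<noteq> 0"
    \<comment> \<open>Over the two-element field the coordinate sum is the parity of the weight.\<close>
    have "hamming_dist \<delta> 0 \<noteq> 3"
    proof
      assume "hamming_dist \<delta> 0 = 3"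
      moreover have "coord_sum \<delta> = (\<Sum>v\<in>{v. \<delta> $ v \<noteq> 0}. 1)"
      proof -
        have "coord_sum \<delta> = (\<Sum>v\<in>{v. \<delta> $ v \<noteq> 0}. \<delta> $ v)"
          unfolding coord_sum_def by (rule sum.mono_neutral_right) auto
        also have "\<dots> = (\<Sum>v\<in>{v. \<delta> $ v \<noteq> 0}. 1)"
          by (rule sum.cong) (use bin in auto)
        finally show ?thesis .
      qed
      ultimately have "coord_sum \<delta> = of_nat 3" by (simp add: hamming_dist_def)
      then have "coord_sum \<delta> = 1 + 1 + 1" by (simp add: numeral_eq_Suc)
      then have "coord_sum \<delta> = 1" by (simp only: two add_0_left)
      then show False using \<delta>(1) by (simp add: reed_muller_iff)
    qed
    then show "4 \<le> hamming_dist \<delta> 0" using min_distance_reed_muller_ge[OF \<delta>] by simp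
  qed
  then show ?thesis using True by simp
qed

lemma linear_code_params_reed_muller:
  assumes "CARD('q) = 2 \<longrightarrow> CARD('d) \<ge> 2"
  shows "linear_code_params (reed_muller :: ('q::{field,finite} ^ ('q ^ 'd)) set)
    (CARD('q) ^ CARD('d)) (CARD('q) ^ CARD('d) - CARD('d) - 1) (if CARD('q) = 2 then 4 else 3)"
  unfolding linear_code_params_def
  using subspace_reed_muller dim_reed_muller min_distance_reed_muller[OF assms]
  by (simp add: CARD_vec)

section \<open>Sums over the support of a binary word\<close>

definition support_sum :: "('i \<Rightarrow> 'a::comm_monoid_add) \<Rightarrow> bit ^ 'i \<Rightarrow> 'a" where
  "support_sum h \<alpha> = (\<Sum>i | \<alpha> $ i = 1. h i)"

lemma support_sum_add:
  assumes "\<And>i. h i + h i = 0"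
  shows "support_sum h (\<alpha> + \<beta>) = support_sum h \<alpha> + support_sum h \<beta>"
proof -
  have *: "support_sum h \<gamma> = (\<Sum>i\<in>UNIV. if \<gamma> $ i = 1 then h i else 0)" for \<gamma>
    unfolding support_sum_def by (subst sum.inter_filter[symmetric]) simp_all
  have "(if (\<alpha> + \<beta>) $ i = 1 then h i else 0)
      = (if \<alpha> $ i = 1 then h i else 0) + (if \<beta> $ i = 1 then h i else 0)" for i
    using assms by (cases "\<alpha> $ i"; cases "\<beta> $ i") simp_all
  then show ?thesis unfolding * by (simp add: sum.distrib)
qed

lemma support_sum_axis: "support_sum h (axis (j :: 'i::finite) 1) = h j"
proof -
  have "{i. (axis j 1 :: bit ^ 'i) $ i = 1} = {j}" by (auto simp: axis_def)
  then show ?thesis by (simp add: support_sum_def)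
qed

lemma support_Plus:
  "{i. \<alpha> $ i = 1} = {x. \<alpha> $ Inl x = 1} <+> {y. \<alpha> $ Inr y = (1 :: bit)}"
proof -
  have "i \<in> {i. \<alpha> $ i = 1} \<longleftrightarrow> i \<in> {x. \<alpha> $ Inl x = 1} <+> {y. \<alpha> $ Inr y = 1}" for i
    by (cases i) auto
  then show ?thesis by blast
qed

lemma support_sum_Plus:
  "support_sum h \<alpha> = (\<Sum>x | \<alpha> $ Inl x = 1. h (Inl x)) + (\<Sum>y | \<alpha> $ Inr y = 1. h (Inr y))"
  unfolding support_sum_def support_Plus by (simp add: sum.Plus comp_def)

lemma of_nat_bit_eq_0_iff: "(of_nat n :: bit) = 0 \<longleftrightarrow> even n"
  by (induction n) (auto simp: bit_add_eq_0_iff)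

lemma weight_Plus:
  "hamming_dist (\<alpha> :: bit ^ ('a::finite + 'b::finite)) 0 = card {x. \<alpha> $ Inl x = 1} + card {y. \<alpha> $ Inr y = 1}"
  by (simp add: hamming_dist_def support_Plus card_Plus)

section \<open>Preparata codes\<close>

locale preparata_field =
  fixes F :: "'f::{field,finite} itself" and d \<sigma> :: nat
  assumes d: "2 \<le> d" and card_F: "CARD('f) = 2 ^ (2 * d - 1)"
    and exponent: "preparata_exponent TYPE('f) \<sigma>"
begin

lemma two_eq_0 [simp]: "(2 :: 'f) = 0"
proof -
  have "bij (\<lambda>x :: 'f. x + 1)"
    by (rule bij_betw_byWitness[where f' = "\<lambda>x. x - 1"]) auto
  then have "(\<Sum>x\<in>UNIV. x + 1 :: 'f) = (\<Sum>x\<in>UNIV. x)"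
    by (rule sum.reindex_bij_betw)
  then have "(of_nat CARD('f) :: 'f) = 0" by (simp add: sum.distrib)
  then show ?thesis by (simp add: card_F)
qed

lemma add_self [simp]: "x + x = (0 :: 'f)"
  using mult_2[of x] by simp

lemma add_eq_0_iff_eq: "x + y = 0 \<longleftrightarrow> x = (y :: 'f)"
  by (metis add_self add_right_cancel)

lemma power_sigma_add: "(x + y) ^ \<sigma> = x ^ \<sigma> + (y :: 'f) ^ \<sigma>"
proof -
  have "(x + y) ^ (2 ^ k) = x ^ (2 ^ k) + (y :: 'f) ^ (2 ^ k)" for k
  proof (induction k)
    case (Suc k)
    have sq: "(a + b)\<^sup>2 = a\<^sup>2 + b\<^sup>2" for a b :: 'f
    proof -
      have "(a + b)\<^sup>2 = a\<^sup>2 + b\<^sup>2 + (a * b + a * b)"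
        by (simp add: power2_eq_square algebra_simps del: add_self)
      then show ?thesis by simp
    qed
    have "z ^ (2 ^ Suc k) = (z ^ (2 ^ k))\<^sup>2" for z :: 'f
      by (simp add: power_mult[symmetric] mult.commute)
    then show ?case by (simp only: Suc.IH sq)
  qed simp
  then show ?thesis using exponent by (auto simp: preparata_exponent_def)
qed

lemma power_Suc_sigma_eq_iff: "x ^ (\<sigma> + 1) = y ^ (\<sigma> + 1) \<longleftrightarrow> x = (y :: 'f)"
  using exponent unfolding preparata_exponent_def by (metis (no_types, lifting) bij_is_inj injD)

lemma ex_power_Suc_sigma: "\<exists>c :: 'f. c ^ (\<sigma> + 1) = w"
  using exponent unfolding preparata_exponent_def by (metis (no_types, lifting) bij_is_surj surjD)

lemma power_sigma_diff_1_eq_iff: "x ^ (\<sigma> - 1) = y ^ (\<sigma> - 1) \<longleftrightarrow> x = (y :: 'f)"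
  using exponent unfolding preparata_exponent_def by (metis (no_types, lifting) bij_is_inj injD)

lemma sigma_ge_2: "2 \<le> \<sigma>"
proof -
  have "\<sigma> - 1 \<noteq> 0" using power_sigma_diff_1_eq_iff[of 0 1] by auto
  then show ?thesis by simp
qed

text \<open>
  The symmetric biadditive form that measures how far the \<open>(\<sigma> + 1)\<close>-th power is from being additive.
\<close>

definition polar :: "'f \<Rightarrow> 'f \<Rightarrow> 'f" where
  "polar x y = x ^ \<sigma> * y + x * y ^ \<sigma>"

lemma power_Suc_sigma_add:
  "(x + y) ^ (\<sigma> + 1) = x ^ (\<sigma> + 1) + (y :: 'f) ^ (\<sigma> + 1) + polar x y"
  by (simp add: power_sigma_add polar_def algebra_simps)

lemma polar_mult: "polar (c * x) (c * y) = c ^ (\<sigma> + 1) * polar x y"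
  by (simp add: polar_def power_mult_distrib algebra_simps)

text \<open>
  For nonzero \<open>x\<close> and \<open>y\<close> the form vanishes only if \<open>x ^ (\<sigma> - 1) = y ^ (\<sigma> - 1)\<close>, and the
  \<open>(\<sigma> - 1)\<close>-th power is injective.
\<close>

lemma polar_eq_0D:
  assumes "polar x y = 0" "x \<noteq> 0" "y \<noteq> 0"
  shows "x = y"
proof -
  have split: "z ^ \<sigma> = z * z ^ (\<sigma> - 1)" for z :: 'f
    using sigma_ge_2 by (metis power_minus_mult mult.commute not_less less_le_trans zero_less_numeral)
  have "x ^ \<sigma> * y = x * y ^ \<sigma>" using assms(1) by (simp add: polar_def add_eq_0_iff_eq)
  then have "(x * y) * x ^ (\<sigma> - 1) = (x * y) * y ^ (\<sigma> - 1)" by (simp add: split mult_ac)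
  then show ?thesis using assms(2,3) power_sigma_diff_1_eq_iff[of x y] by simp
qed

lemma ex_not_0_1: obtains u :: 'f where "u \<noteq> 0" "u \<noteq> 1"
proof -
  have "2 ^ 3 \<le> CARD('f)" unfolding card_F by (rule power_increasing) (use d in auto)
  then have "\<not> CARD('f) \<le> card {0, 1 :: 'f}" by simp
  then have "\<not> UNIV \<subseteq> {0, 1 :: 'f}" using card_mono[of "{0, 1 :: 'f}" UNIV] by auto
  then show thesis using that by blast
qed

text \<open>
  The form is homogeneous for the powers \<open>c ^ (\<sigma> + 1)\<close>, which are all elements of the field, so a
  single nonzero value already gives all values.
\<close>

lemma ex_polar: "\<exists>x y. polar x y = w"
proof -
  obtain u :: 'f where u: "u \<noteq> 0" "u \<noteq> 1" by (rule ex_not_0_1)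
  then have ne: "polar 1 u \<noteq> 0" using polar_eq_0D[of 1 u] by auto
  obtain c :: 'f where "c ^ (\<sigma> + 1) = w / polar 1 u" using ex_power_Suc_sigma by blast
  then have "polar (c * 1) (c * u) = w" using ne unfolding polar_mult by simp
  then show ?thesis by blast
qed

text \<open>
  A solution would satisfy \<open>(u + 1) ^ (\<sigma> + 1) = u * u ^ \<sigma> = u ^ (\<sigma> + 1)\<close>, against the injectivity
  of the \<open>(\<sigma> + 1)\<close>-th power.
\<close>

lemma power_sigma_ne_add_1: "u ^ \<sigma> \<noteq> u + (1 :: 'f)"
proof
  assume u: "u ^ \<sigma> = u + 1"
  have "(u + 1) ^ (\<sigma> + 1) = (u ^ \<sigma> + 1) * (u + 1)" by (simp add: power_sigma_add)
  also have "u ^ \<sigma> + 1 = u" by (simp add: u add.assoc)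
  also have "u * (u + 1) = u ^ (\<sigma> + 1)" by (simp add: u)
  finally have "u + 1 = u" by (simp only: power_Suc_sigma_eq_iff)
  then show False by simp
qed

text \<open>
  A word \<open>(X, Y)\<close> is described by the parities of \<open>X\<close> and \<open>Y\<close>, the difference of their sums, the
  sum over \<open>X\<close>, and the joint sum of \<open>(\<sigma> + 1)\<close>-th powers. Taken together these form the
  additive map \<open>syndrome\<close>, and the code is the preimage of a graph over the fourth component.
\<close>

definition par_left :: "bit ^ ('f + 'f) \<Rightarrow> bit" where
  "par_left = support_sum (case_sum (\<lambda>_. 1) (\<lambda>_. 0))"

definition par_right :: "bit ^ ('f + 'f) \<Rightarrow> bit" where
  "par_right = support_sum (case_sum (\<lambda>_. 0) (\<lambda>_. 1))"

definition total :: "bit ^ ('f + 'f) \<Rightarrow> 'f" where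
  "total = support_sum (case_sum (\<lambda>x. x) (\<lambda>y. y))"

definition left_sum :: "bit ^ ('f + 'f) \<Rightarrow> 'f" where
  "left_sum = support_sum (case_sum (\<lambda>x. x) (\<lambda>_. 0))"

definition power_total :: "bit ^ ('f + 'f) \<Rightarrow> 'f" where
  "power_total = support_sum (case_sum (\<lambda>x. x ^ (\<sigma> + 1)) (\<lambda>y. y ^ (\<sigma> + 1)))"

definition syndrome :: "bit ^ ('f + 'f) \<Rightarrow> bit \<times> bit \<times> 'f \<times> 'f \<times> 'f" where
  "syndrome \<alpha> = (par_left \<alpha>, par_right \<alpha>, total \<alpha>, left_sum \<alpha>, power_total \<alpha>)"

lemma syndrome_components_add [simp]:
  "par_left (\<alpha> + \<beta>) = par_left \<alpha> + par_left \<beta>"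
  "par_right (\<alpha> + \<beta>) = par_right \<alpha> + par_right \<beta>"
  "total (\<alpha> + \<beta>) = total \<alpha> + total \<beta>"
  "left_sum (\<alpha> + \<beta>) = left_sum \<alpha> + left_sum \<beta>"
  "power_total (\<alpha> + \<beta>) = power_total \<alpha> + power_total \<beta>"
  unfolding par_left_def par_right_def total_def left_sum_def power_total_def
  by (rule support_sum_add; simp split: sum.split)+

lemma syndrome_components_axis [simp]:
  "par_left (axis (Inl x) 1) = 1" "par_left (axis (Inr x) 1) = 0"
  "par_right (axis (Inl x) 1) = 0" "par_right (axis (Inr x) 1) = 1"
  "total (axis (Inl x) 1) = x" "total (axis (Inr x) 1) = x"
  "left_sum (axis (Inl x) 1) = x" "left_sum (axis (Inr x) 1) = 0"
  "power_total (axis (Inl x) 1) = x ^ (\<sigma> + 1)" "power_total (axis (Inr x) 1) = x ^ (\<sigma> + 1)"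
  by (simp_all add: par_left_def par_right_def total_def left_sum_def power_total_def
      support_sum_axis)

lemma syndrome_components_0 [simp]:
  "par_left 0 = 0" "par_right 0 = 0" "total 0 = 0" "left_sum 0 = 0" "power_total 0 = 0"
  by (simp_all add: par_left_def par_right_def total_def left_sum_def power_total_def support_sum_def)

lemma syndrome_components_sets:
  "par_left \<alpha> = 0 \<longleftrightarrow> even (card {x. \<alpha> $ Inl x = 1})"
  "par_right \<alpha> = 0 \<longleftrightarrow> even (card {y. \<alpha> $ Inr y = 1})"
  "total \<alpha> = (\<Sum>x | \<alpha> $ Inl x = 1. x) + (\<Sum>y | \<alpha> $ Inr y = 1. y)"
  "left_sum \<alpha> = (\<Sum>x | \<alpha> $ Inl x = 1. x)"
  "power_total \<alpha> = (\<Sum>x | \<alpha> $ Inl x = 1. x ^ (\<sigma> + 1)) + (\<Sum>y | \<alpha> $ Inr y = 1. y ^ (\<sigma> + 1))"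
  by (simp_all add: par_left_def par_right_def total_def left_sum_def power_total_def
      support_sum_Plus of_nat_bit_eq_0_iff)

lemma preparata_iff:
  "\<alpha> \<in> preparata \<sigma> \<longleftrightarrow> par_left \<alpha> = 0 \<and> par_right \<alpha> = 0 \<and> total \<alpha> = 0
    \<and> power_total \<alpha> = left_sum \<alpha> ^ (\<sigma> + 1)"
proof -
  have "a + b = c \<longleftrightarrow> a + c = b" for a b c :: 'f
    by (metis add_self add.assoc add.commute add_0_right)
  then show ?thesis
    unfolding syndrome_components_sets preparata_def Let_def
    by (simp only: bit_not_zero_iff mem_Collect_eq add_eq_0_iff_eq add_0_right)
qed

lemma surj_syndrome: "surj syndrome"
proof -
  have "\<exists>\<alpha>. syndrome \<alpha> = (a, b, r, s, t)" for a b r s t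
  proof -
    \<comment> \<open>Four points of the second copy with sum zero shift only the last component.\<close>
    obtain x y where xy: "polar x y = t + s ^ (\<sigma> + 1) + (r + s) ^ (\<sigma> + 1)" using ex_polar by blast
    define \<delta> :: "bit ^ ('f + 'f)" where "\<delta> = axis (Inr x) 1 + axis (Inr y) 1 + axis (Inr (x + y)) 1 + axis (Inr 0) 1"
    have \<delta>: "par_left \<delta> = 0" "par_right \<delta> = 0" "total \<delta> = 0" "left_sum \<delta> = 0"
      "power_total \<delta> = polar x y"
      by (simp_all add: \<delta>_def power_sigma_add polar_def) (simp_all add: algebra_simps)
    \<comment> \<open>The point 0 of either copy corrects its parity without changing any of the sums.\<close>
    define \<epsilon> :: "bit ^ ('f + 'f)" where "\<epsilon> = axis (Inl s) 1 + axis (Inr (r + s)) 1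
      + (if a = 0 then axis (Inl 0) 1 else 0) + (if b = 0 then axis (Inr 0) 1 else 0)"
    have \<epsilon>: "par_left \<epsilon> = a" "par_right \<epsilon> = b" "total \<epsilon> = r" "left_sum \<epsilon> = s"
      "power_total \<epsilon> = s ^ (\<sigma> + 1) + (r + s) ^ (\<sigma> + 1)"
      by (simp_all add: \<epsilon>_def)
    have "syndrome (\<delta> + \<epsilon>) = (a, b, r, s, t)"
      by (simp add: syndrome_def \<delta> \<epsilon> xy)
    then show ?thesis by blast
  qed
  then show ?thesis by (metis surj_def surj_pair)
qed

lemma card_syndrome_vimage:
  "card {\<alpha>. syndrome \<alpha> \<in> T} * (4 * CARD('f) ^ 3) = card T * 2 ^ (2 * CARD('f))"
proof -
  have "card {\<alpha> \<in> UNIV. syndrome \<alpha> \<in> T} * card (range syndrome)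
      = card T * card (UNIV :: (bit ^ ('f + 'f)) set)"
    by (rule card_vimage_times_card_image) (use surj_syndrome in \<open>auto simp: syndrome_def\<close>)
  then show ?thesis
    unfolding surj_syndrome by (simp add: CARD_vec CARD_bit mult_2 power3_eq_cube mult_ac)
qed

text \<open>The codewords have one syndrome for each value of \<open>left_sum\<close>.\<close>

lemma card_preparata_times:
  "card (preparata \<sigma> :: (bit ^ ('f + 'f)) set) * (4 * CARD('f) ^ 3) = CARD('f) * 2 ^ (2 * CARD('f))"
proof -
  let ?n = "CARD('f)"
  let ?P = "preparata \<sigma> :: (bit ^ ('f + 'f)) set"
  let ?T = "range (\<lambda>s :: 'f. (0 :: bit, 0 :: bit, 0 :: 'f, s, s ^ (\<sigma> + 1)))"
  have "{\<alpha>. syndrome \<alpha> \<in> ?T} = ?P" by (auto simp: preparata_iff syndrome_def)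
  moreover have "card ?T = ?n" by (rule card_image) (auto simp: inj_on_def)
  ultimately show ?thesis using card_syndrome_vimage[of ?T] by simp
qed

lemma card_preparata: "card (preparata \<sigma> :: (bit ^ ('f + 'f)) set) = 2 ^ (2 ^ (2 * d) - 4 * d)"
proof -
  let ?n = "CARD('f)"
  let ?P = "preparata \<sigma> :: (bit ^ ('f + 'f)) set"
  have "card ?P * (4 * ?n ^ 3) = ?n * 2 ^ (2 * ?n)" by (rule card_preparata_times)
  then have "card ?P * (2 * ?n)\<^sup>2 = 2 ^ (2 * ?n)"
    by (simp add: power2_eq_square power3_eq_cube)
  moreover have n: "2 * ?n = 2 ^ (2 * d)"
    using d by (simp add: card_F power_Suc[symmetric])
  ultimately have "card ?P * 2 ^ (4 * d) = 2 ^ (2 ^ (2 * d))"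
    by (simp add: power_mult[symmetric])
  moreover have "4 * d \<le> 2 ^ (2 * d)"
    using d
  proof (induction d rule: dec_induct)
    case (step k)
    have "(2::nat) ^ 2 \<le> 2 ^ (2 * k)" by (rule power_increasing) (use step in auto)
    then show ?case using step by simp
  qed simp
  ultimately show ?thesis
    by (metis (no_types, lifting) le_add_diff_inverse2 mult_right_cancel power_add power_not_zero zero_neq_numeral)
qed


subsection \<open>Minimum distance\<close>

text \<open>
  The words with even parts and equal sums form an extended Hamming code. It is linear and contains
  the Preparata code, hence also all sums of two codewords.
\<close>

definition supercode :: "(bit ^ ('f + 'f)) set" where
  "supercode = {\<alpha>. par_left \<alpha> = 0 \<and> par_right \<alpha> = 0 \<and> total \<alpha> = 0}"

lemma supercode_weight_ge_4:
  assumes "\<gamma> \<in> supercode" "\<gamma> \<noteq> 0"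
  shows "4 \<le> hamming_dist \<gamma> 0"
proof (rule ccontr)
  let ?A = "{x. \<gamma> $ Inl x = 1}" and ?B = "{y. \<gamma> $ Inr y = 1}"
  assume "\<not> 4 \<le> hamming_dist \<gamma> 0"
  then have small: "card ?A + card ?B < 4" by (simp add: weight_Plus)
  have nz: "card ?A + card ?B \<noteq> 0"
    using assms(2) by (metis weight_Plus hamming_dist_eq_0_iff)
  have ev: "even (card ?A)" "even (card ?B)" and tot: "\<Sum>?A + \<Sum>?B = 0"
    using assms(1) by (simp_all add: supercode_def syndrome_components_sets)
  have no2: "\<Sum>S \<noteq> 0" if S: "card S = 2" for S :: "'f set"
  proof -
    obtain x y where "S = {x, y}" "x \<noteq> y" using S by (metis card_2_iff)
    then show ?thesis by (simp add: add_eq_0_iff_eq)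
  qed
  have "card ?A = 2 \<and> card ?B = 0 \<or> card ?A = 0 \<and> card ?B = 2"
    using small nz ev by presburger
  then show False using tot no2[of ?A] no2[of ?B] by auto
qed

lemma sum_in_supercode:
  fixes \<alpha> \<beta> :: "bit ^ ('f + 'f)"
  assumes "\<alpha> \<in> preparata \<sigma>" "\<beta> \<in> preparata \<sigma>"
  shows "\<alpha> + \<beta> \<in> supercode"
  using assms by (simp add: preparata_iff supercode_def)

text \<open>
  The sums of \<open>(\<sigma> + 1)\<close>-th powers over an even set with sum zero are invariant under translation
  of the set, so one of four points can be moved to the origin, and the form \<open>polar\<close> then vanishes
  at two different nonzero points.
\<close>

lemma card_4_power_sum:
  fixes S :: "'f set"
  assumes "card S = 4" "\<Sum>S = 0"
  shows "(\<Sum>x\<in>S. x ^ (\<sigma> + 1)) \<noteq> 0"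
proof
  assume sum0: "(\<Sum>x\<in>S. x ^ (\<sigma> + 1)) = 0"
  obtain a T where S: "S = insert a T" "a \<notin> T" "card T = 3"
    using assms(1) by (metis card_Suc_eq eval_nat_numeral(3) semiring_norm(26,27) numeral_eq_Suc pred_numeral_simps(2))
  then obtain b c e where T: "T = {b, c, e}" "b \<noteq> c" "b \<noteq> e" "c \<noteq> e"
    by (auto simp: card_3_iff)
  have "a + b + c + e = 0" using assms(2) S T by (simp add: add.assoc)
  then have e: "e = a + b + c" by (simp add: add_eq_0_iff_eq)
  have "polar (a + b) (a + c) = (\<Sum>x\<in>S. x ^ (\<sigma> + 1))"
    using S T by (simp add: e polar_def power_sigma_add) (simp add: algebra_simps)
  then have "polar (a + b) (a + c) = 0" using sum0 by simp
  then have "a + b = 0 \<or> a + c = 0 \<or> a + b = a + c" using polar_eq_0D by blast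
  then show False using S T by (auto simp: add_eq_0_iff_eq)
qed

text \<open>
  If \<open>s\<close> is the left sum of one of two codewords, their sum \<open>\<gamma>\<close> satisfies
  \<open>power_total \<gamma> = left_sum \<gamma> ^ (\<sigma> + 1) + polar s (left_sum \<gamma>)\<close>. As \<open>\<gamma>\<close> belongs to \<open>supercode\<close>, it
  remains to exclude weight 4. Four points in one copy contradict the preceding lemma. If the two
  parts are \<open>{x, x + a}\<close> and \<open>{y, y + a}\<close>, division by \<open>a ^ (\<sigma> + 1)\<close> gives \<open>u ^ \<sigma> = u + 1\<close> for
  \<open>u = (x + y + s) / a\<close>.
\<close>

lemma preparata_dist_ge_6:
  fixes \<alpha> \<beta> :: "bit ^ ('f + 'f)"
  assumes \<alpha>: "\<alpha> \<in> preparata \<sigma>" and \<beta>: "\<beta> \<in> preparata \<sigma>" and "\<alpha> \<noteq> \<beta>"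
  shows "6 \<le> hamming_dist \<alpha> \<beta>"
proof (rule ccontr)
  define \<gamma> where "\<gamma> = \<alpha> + \<beta>"
  let ?A = "{x. \<gamma> $ Inl x = 1}" and ?B = "{y. \<gamma> $ Inr y = 1}"
  define s where "s = left_sum \<alpha>"
  define a where "a = left_sum \<gamma>"
  assume "\<not> 6 \<le> hamming_dist \<alpha> \<beta>"
  moreover have "hamming_dist \<gamma> 0 = hamming_dist \<alpha> \<beta>"
    by (simp only: \<gamma>_def bit_vec_diff[symmetric] hamming_dist_diff_0)
  ultimately have small: "card ?A + card ?B < 6" by (simp only: weight_Plus not_le)
  have "\<gamma> \<noteq> 0" using \<open>\<alpha> \<noteq> \<beta>\<close> by (metis \<gamma>_def bit_vec_diff right_minus_eq)
  have supercode: "\<gamma> \<in> supercode" unfolding \<gamma>_def using \<alpha> \<beta> by (rule sum_in_supercode)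
  then have "4 \<le> card ?A + card ?B"
    using supercode_weight_ge_4 \<open>\<gamma> \<noteq> 0\<close> by (metis weight_Plus)
  moreover have ev: "even (card ?A)" "even (card ?B)" and tot: "\<Sum>?A = \<Sum>?B"
    using supercode by (simp_all add: supercode_def syndrome_components_sets add_eq_0_iff_eq)
  ultimately have "card ?A = 4 \<and> card ?B = 0 \<or> card ?A = 0 \<and> card ?B = 4 \<or> card ?A = 2 \<and> card ?B = 2"
    using small by presburger
  then consider "card ?A = 4" "card ?B = 0" | "card ?A = 0" "card ?B = 4"
    | "card ?A = 2" "card ?B = 2" by (elim disjE) simp_all
  note cases = this
  have a: "a = \<Sum>?A" by (simp add: a_def syndrome_components_sets)
  have left_\<beta>: "left_sum \<beta> = s + a" by (simp add: a_def s_def \<gamma>_def add.assoc[symmetric])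
  have "power_total \<gamma> = s ^ (\<sigma> + 1) + (s + a) ^ (\<sigma> + 1)"
    using \<alpha> \<beta> left_\<beta> by (simp add: \<gamma>_def preparata_iff s_def)
  also have "\<dots> = a ^ (\<sigma> + 1) + polar s a"
    by (simp only: power_Suc_sigma_add) (simp add: add.assoc[symmetric])
  finally have power: "(\<Sum>x\<in>?A. x ^ (\<sigma> + 1)) + (\<Sum>y\<in>?B. y ^ (\<sigma> + 1)) = a ^ (\<sigma> + 1) + polar s a"
    by (simp only: syndrome_components_sets)
  from cases show False
  proof cases
    case 1
    then have "a = 0" using a tot by simp
    then show False using 1 power card_4_power_sum[of ?A] a by (simp add: polar_def)
  next
    case 2
    then have "a = 0" using a by simp
    then show False using 2 power card_4_power_sum[of ?B] a tot by (simp add: polar_def)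
  next
    case 3
    obtain x x' where A: "?A = {x, x'}" "x \<noteq> x'" using 3(1) by (metis card_2_iff)
    obtain y y' where B: "?B = {y, y'}" "y \<noteq> y'" using 3(2) by (metis card_2_iff)
    have ax: "a = x + x'" and ay: "a = y + y'" using a tot A B by simp_all
    have x': "x' = x + a" unfolding ax by (simp add: add.assoc[symmetric])
    have y': "y' = y + a" unfolding ay by (simp add: add.assoc[symmetric])
    have "a \<noteq> 0" using A(2) ax by (simp add: add_eq_0_iff_eq)
    define u where "u = (x + y + s) / a"
    have ua: "u * a = x + y + s" using \<open>a \<noteq> 0\<close> by (simp add: u_def)
    have "polar (u * a) a = a ^ (\<sigma> + 1)"
    proof -
      have "x ^ (\<sigma> + 1) + (x + a) ^ (\<sigma> + 1) + (y ^ (\<sigma> + 1) + (y + a) ^ (\<sigma> + 1)) = a ^ (\<sigma> + 1) + polar s a"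
        using power A B by (simp only: x' y') simp
      then have "polar x a + polar y a + polar s a = a ^ (\<sigma> + 1)"
        unfolding power_Suc_sigma_add by (simp add: polar_def algebra_simps)
      then show ?thesis unfolding ua by (simp add: polar_def power_sigma_add algebra_simps)
    qed
    then have "(u ^ \<sigma> + u) * a ^ (\<sigma> + 1) = 1 * a ^ (\<sigma> + 1)"
      by (simp add: polar_def power_mult_distrib algebra_simps)
    then have "u ^ \<sigma> + u = 1" using \<open>a \<noteq> 0\<close> by (simp del: power_Suc)
    then have "u ^ \<sigma> = u + 1" by (metis add_self add.assoc add.commute add_0_right)
    then show False by (rule notE[OF power_sigma_ne_add_1])
  qed
qed

subsection \<open>Words at distance two from the code\<close>

lemma zero_in_preparata: "(0 :: bit ^ ('f + 'f)) \<in> preparata \<sigma>"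
  by (simp add: preparata_iff)

lemma even_hamming_dist_0:
  "even (hamming_dist \<alpha> 0) \<longleftrightarrow> par_left \<alpha> = par_right \<alpha>"
  unfolding weight_Plus even_add syndrome_components_sets(1,2)[symmetric]
  by (cases "par_left \<alpha>"; cases "par_right \<alpha>") simp_all

text \<open>
  A word at distance 2 from a codeword has even weight and cannot lie in \<open>supercode\<close>, whose minimum
  distance is 4. The spheres of radius 2 around codewords are disjoint, and together they have
  exactly as many elements as there are words of even weight outside \<open>supercode\<close>.
\<close>

lemma words_at_distance_2:
  "{\<beta>. \<exists>\<alpha>\<in>preparata \<sigma>. hamming_dist \<alpha> \<beta> = 2} = {\<beta>. par_left \<beta> = par_right \<beta>} - supercode"
    (is "?N = ?E - _")
proof (rule card_subset_eq)
  let ?n = "CARD('f)"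
  let ?P = "preparata \<sigma> :: (bit ^ ('f + 'f)) set"
  show "?N \<subseteq> ?E - supercode"
  proof
    fix \<beta> assume "\<beta> \<in> ?N"
    then obtain \<alpha> where \<alpha>: "\<alpha> \<in> ?P" "hamming_dist \<alpha> \<beta> = 2" by blast
    then have w: "hamming_dist (\<alpha> + \<beta>) 0 = 2" by (metis bit_vec_diff hamming_dist_diff_0)
    then have "par_left (\<alpha> + \<beta>) = par_right (\<alpha> + \<beta>)"
      by (simp only: even_hamming_dist_0[symmetric]) simp
    moreover have "par_left \<alpha> = 0" "par_right \<alpha> = 0" using \<alpha>(1) by (simp_all only: preparata_iff)
    ultimately have "par_left \<beta> = par_right \<beta>"
      by (simp only: syndrome_components_add add_0_left)
    moreover have "\<beta> \<notin> supercode"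
    proof
      assume "\<beta> \<in> supercode"
      then have "\<alpha> + \<beta> \<in> supercode" using \<alpha>(1) by (simp add: preparata_iff supercode_def)
      moreover have "\<alpha> + \<beta> \<noteq> 0" using w by auto
      ultimately show False using supercode_weight_ge_4[of "\<alpha> + \<beta>"] w by simp
    qed
    ultimately show "\<beta> \<in> ?E - supercode" by simp
  qed
  have "card {\<beta>. \<exists>\<alpha>\<in>?P. hamming_dist \<alpha> \<beta> \<in> {2}} = card ?P * (\<Sum>r\<in>{2}. CARD('f + 'f) choose r)"
  proof (rule card_union_spheres)
    show "2 * 2 < hamming_dist \<alpha> \<beta>" if "\<alpha> \<in> ?P" "\<beta> \<in> ?P" "\<alpha> \<noteq> \<beta>" for \<alpha> \<beta>
      using preparata_dist_ge_6[OF that] by simp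
  qed auto
  then have N: "card ?N = card ?P * (?n * (2 * ?n - 1))"
    by (simp add: mult_2[symmetric] choose_two)
  have E: "card (?E - supercode) * (4 * ?n ^ 3) = (2 * ?n - 1) * ?n\<^sup>2 * 2 ^ (2 * ?n)"
  proof -
    let ?T = "(\<lambda>((b, c), s, t). (b :: bit, b, c :: 'f, s :: 'f, t :: 'f)) ` ((UNIV - {(0, 0)}) \<times> UNIV \<times> UNIV)"
    \<comment> \<open>The syndromes to be counted are \<open>(b, b, c, s, t)\<close> with \<open>(b, c)\<close> nonzero.\<close>
    have "(b, b', c, s, t) \<in> ?T \<longleftrightarrow> b = b' \<and> \<not> (b = 0 \<and> c = 0)" for b b' c s t
    proof
      assume "b = b' \<and> \<not> (b = 0 \<and> c = 0)"
      then show "(b, b', c, s, t) \<in> ?T" by (intro image_eqI[of _ _ "((b, c), s, t)"]) auto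
    qed auto
    then have "{\<alpha>. syndrome \<alpha> \<in> ?T} = ?E - supercode"
      unfolding syndrome_def supercode_def by auto
    moreover have "card ?T = card ((UNIV - {(0 :: bit, 0 :: 'f)}) \<times> (UNIV :: 'f set) \<times> (UNIV :: 'f set))"
      by (rule card_image) (auto simp: inj_on_def)
    moreover have "\<dots> = (2 * ?n - 1) * ?n\<^sup>2"
      by (simp add: card_cartesian_product card_Diff_singleton CARD_bit power2_eq_square)
    ultimately show ?thesis using card_syndrome_vimage[of ?T] by simp
  qed
  have P: "card ?P * (4 * ?n ^ 3) = ?n * 2 ^ (2 * ?n)"
    by (rule card_preparata_times)
  have "card ?N * (4 * ?n ^ 3) = (?n * (2 * ?n - 1)) * (card ?P * (4 * ?n ^ 3))"
    by (simp only: N mult_ac)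
  also have "\<dots> = card (?E - supercode) * (4 * ?n ^ 3)"
    unfolding E P by (simp add: power2_eq_square)
  finally show "card ?N = card (?E - supercode)" by simp
qed simp

lemma neighbours_preparata: "neighbours (preparata \<sigma>) 2 = {\<beta>. par_left \<beta> = par_right \<beta>} - supercode"
proof -
  have ne: "(preparata \<sigma> :: (bit ^ ('f + 'f)) set) \<noteq> {}" using zero_in_preparata by blast
  have "dist_to_code \<beta> (preparata \<sigma>) = 2 \<longleftrightarrow> (\<exists>\<alpha>\<in>preparata \<sigma>. hamming_dist \<alpha> \<beta> = 2)" for \<beta> :: "bit ^ ('f + 'f)"
  proof -
    have "2 \<le> hamming_dist \<beta> \<alpha>'" if "\<alpha> \<in> preparata \<sigma>" "hamming_dist \<alpha> \<beta> = 2" "\<alpha>' \<in> preparata \<sigma>" for \<alpha> \<alpha>'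
      using preparata_dist_ge_6[OF that(1,3)] hamming_dist_triangle[of \<alpha> \<alpha>' \<beta>] that(2)
      by (cases "\<alpha> = \<alpha>'") (auto simp: hamming_dist_commute)
    then show ?thesis
      using dist_to_code_eq_iff[OF ne, of \<beta> 2] by (metis hamming_dist_commute)
  qed
  then show ?thesis unfolding neighbours_def words_at_distance_2[symmetric] by simp
qed

lemma min_distance_preparata: "min_distance (preparata \<sigma> :: (bit ^ ('f + 'f)) set) = 6"
proof -
  obtain u :: 'f where u: "u \<noteq> 0" "u \<noteq> 1" by (rule ex_not_0_1)
  \<comment> \<open>A word of weight 4 with odd parts; the codeword next to it has weight at most 6.\<close>
  let ?\<beta> = "axis (Inl 0) 1 + axis (Inr 0) 1 + axis (Inr 1) 1 + axis (Inr u) 1 :: bit ^ ('f + 'f)"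
  have "{i. ?\<beta> $ i = 1} = {Inl 0, Inr 0, Inr 1, Inr u}"
    using u by (auto simp: axis_def)
  then have w: "hamming_dist ?\<beta> 0 = 4" using u by (simp add: hamming_dist_def)
  have "par_left ?\<beta> = 1" "par_right ?\<beta> = 1" by simp_all
  then have "?\<beta> \<in> {\<beta>. par_left \<beta> = par_right \<beta>} - supercode" by (simp add: supercode_def)
  then obtain \<alpha> where \<alpha>: "\<alpha> \<in> preparata \<sigma>" "hamming_dist \<alpha> ?\<beta> = 2"
    unfolding words_at_distance_2[symmetric] by blast
  have "\<alpha> \<noteq> 0"
  proof
    assume "\<alpha> = 0"
    then show False using \<alpha>(2) w hamming_dist_commute[of 0 ?\<beta>] by simp
  qed
  then have "6 \<le> hamming_dist \<alpha> 0" using preparata_dist_ge_6[OF \<alpha>(1) zero_in_preparata] by simp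
  moreover have "hamming_dist \<alpha> 0 \<le> 6" using hamming_dist_triangle[of \<alpha> 0 ?\<beta>] \<alpha>(2) w by simp
  ultimately have "hamming_dist \<alpha> 0 = 6" by simp
  then show ?thesis
    using \<alpha>(1) zero_in_preparata \<open>\<alpha> \<noteq> 0\<close> preparata_dist_ge_6 by (intro min_distance_eqI[of \<alpha> _ 0]) auto
qed

lemma syndrome_vimage: obtains \<alpha> where "syndrome \<alpha> = p"
  using surj_syndrome by (metis surjD)

text \<open>
  Adding an element of the linear code \<open>supercode\<close> preserves the set of words of even weight outside
  it, but an element outside the Preparata code moves the codeword zero out of that code.
\<close>

lemma elusive_preparata: "elusive 2 (preparata \<sigma> :: (bit ^ ('f + 'f)) set)"
proof -
  let ?P = "preparata \<sigma> :: (bit ^ ('f + 'f)) set"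
  obtain \<eta> where "syndrome \<eta> = (0, 0, 0, 0, 1)" by (rule syndrome_vimage)
  then have \<eta>: "par_left \<eta> = 0" "par_right \<eta> = 0" "total \<eta> = 0" "left_sum \<eta> = 0" "power_total \<eta> = 1"
    by (simp_all add: syndrome_def)
  obtain \<beta> where "syndrome \<beta> = (1, 1, 0, 0, 0)" by (rule syndrome_vimage)
  then have \<beta>: "\<beta> \<in> neighbours ?P 2"
    unfolding neighbours_preparata by (simp add: supercode_def syndrome_def)
  show ?thesis
  proof (rule elusive_translateI)
    show "neighbours ?P 2 \<noteq> {}" using \<beta> by blast
    have "0 + \<eta> \<in> (\<lambda>\<alpha>. \<alpha> + \<eta>) ` ?P" by (rule imageI) (rule zero_in_preparata)
    moreover have "0 + \<eta> \<notin> ?P" using \<eta> by (simp add: preparata_iff)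
    ultimately show "(\<lambda>\<alpha>. \<alpha> + \<eta>) ` ?P \<noteq> ?P" by (intro notI) (simp only:)
    show "(\<lambda>\<alpha>. \<alpha> + \<eta>) ` neighbours ?P 2 = neighbours ?P 2"
    proof (rule endo_inj_surj)
      show "(\<lambda>\<alpha>. \<alpha> + \<eta>) ` neighbours ?P 2 \<subseteq> neighbours ?P 2"
        unfolding neighbours_preparata using \<eta> by (auto simp: supercode_def)
    qed auto
  qed simp
qed

text \<open>
  Adding codewords with left sums \<open>s\<close> and \<open>s'\<close> gives a codeword only if \<open>polar s s' = 0\<close>.
\<close>

lemma preparata_not_subspace: "\<not> vec.subspace (preparata \<sigma> :: (bit ^ ('f + 'f)) set)"
proof
  assume sub: "vec.subspace (preparata \<sigma> :: (bit ^ ('f + 'f)) set)"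
  obtain u :: 'f where u: "u \<noteq> 0" "u \<noteq> 1" by (rule ex_not_0_1)
  obtain \<alpha> where "syndrome \<alpha> = (0, 0, 0, 1, 1)" by (rule syndrome_vimage)
  then have \<alpha>: "\<alpha> \<in> preparata \<sigma>" "left_sum \<alpha> = 1" "power_total \<alpha> = 1"
    by (simp_all add: syndrome_def preparata_iff)
  obtain \<beta> where "syndrome \<beta> = (0, 0, 0, u, u ^ (\<sigma> + 1))" by (rule syndrome_vimage)
  then have \<beta>: "\<beta> \<in> preparata \<sigma>" "left_sum \<beta> = u" "power_total \<beta> = u ^ (\<sigma> + 1)"
    by (simp_all add: syndrome_def preparata_iff)
  have "\<alpha> + \<beta> \<in> preparata \<sigma>" using sub \<alpha>(1) \<beta>(1) by (rule vec.subspace_add)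
  then have "1 ^ (\<sigma> + 1) + u ^ (\<sigma> + 1) = (1 + u) ^ (\<sigma> + 1)"
    using \<alpha> \<beta> by (simp add: preparata_iff del: power_Suc)
  then have "polar 1 u = 0" unfolding power_Suc_sigma_add by (metis add_cancel_right_right)
  then show False using polar_eq_0D[of 1 u] u by simp
qed

end

section \<open>The Golay code\<close>

definition indicator_word :: "'i set \<Rightarrow> bit ^ 'i" where
  "indicator_word S = (\<chi> i. of_bool (i \<in> S))"

abbreviation support :: "bit ^ 'i \<Rightarrow> 'i set" where
  "support x \<equiv> {i. x $ i = 1}"

lemma support_indicator_word [simp]: "support (indicator_word S) = S"
  by (simp add: indicator_word_def)

lemma weight_support: "hamming_dist x 0 = card (support x)"
  by (simp add: hamming_dist_def)

lemma dist_plus_2_inter: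
  fixes x y :: "bit ^ 'a"
  shows "hamming_dist x y + 2 * card (support x \<inter> support y)
  = card (support x) + card (support y)"
proof -
  have "{i. x $ i \<noteq> y $ i} = (support x - support y) \<union> (support y - support x)"
  proof -
    have "x $ i \<noteq> y $ i \<longleftrightarrow> (x $ i = 1 \<and> y $ i \<noteq> 1) \<or> (y $ i = 1 \<and> x $ i \<noteq> 1)" for i
      by (cases "x $ i"; cases "y $ i") simp_all
    then show ?thesis by blast
  qed
  then have "hamming_dist x y = card (support x - support y) + card (support y - support x)"
    unfolding hamming_dist_def by (simp only:) (rule card_Un_disjoint; auto)
  moreover have "card A = card (A - B) + card (A \<inter> B)" for A B :: "'a set"
    by (subst card_Un_disjoint[symmetric]) (auto intro: arg_cong[where f = card])
  from this[of "support x" "support y"] this[of "support y" "support x"]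
  have "card (support x) = card (support x - support y) + card (support x \<inter> support y)"
    and "card (support y) = card (support y - support x) + card (support x \<inter> support y)"
    by (simp_all only: Int_commute)
  ultimately show ?thesis by simp
qed

text \<open>
  The parameters [23, 12, 7] alone force the code to be perfect, and perfectness provides all the
  codewords used below.
\<close>

locale golay =
  fixes C :: "(bit ^ 'n::finite) set" and j :: 'n and e :: "'m::finite \<Rightarrow> 'n"
  assumes golay: "binary_golay C" and e: "bij_betw e UNIV (UNIV - {j})"
begin

lemma subspace: "vec.subspace C"
  and CARD_n: "CARD('n) = 23"
  using golay by (simp_all add: binary_golay_def linear_code_params_def)

lemma CARD_m: "CARD('m) = 22"
  using bij_betw_same_card[OF e] CARD_n by simp

lemma zero_mem: "0 \<in> C"
  using subspace by (rule vec.subspace_0)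

lemma add_mem: "x \<in> C \<Longrightarrow> y \<in> C \<Longrightarrow> x + y \<in> C"
  using subspace by (rule vec.subspace_add)

lemma card_C: "card C = 2 ^ 12"
  using golay card_subspace[OF subspace] by (simp add: binary_golay_def linear_code_params_def CARD_bit)

lemma dist_ge_7: "x \<in> C \<Longrightarrow> y \<in> C \<Longrightarrow> x \<noteq> y \<Longrightarrow> 7 \<le> hamming_dist x y"
  using golay min_distance_le[of x C y] by (simp add: binary_golay_def linear_code_params_def)

lemma codeword_unique:
  assumes "x \<in> C" "y \<in> C" "hamming_dist z x + hamming_dist z y < 7"
  shows "x = y"
  using assms dist_ge_7[of x y] hamming_dist_triangle[of x y z] hamming_dist_commute[of x z] by force

text \<open>
  A ball of radius 3 has \<open>1 + 23 + 253 + 1771 = 2 ^ 11\<close> elements, and the balls around the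
  \<open>2 ^ 12\<close> codewords are disjoint, so together they exhaust the \<open>2 ^ 23\<close> words.
\<close>

lemma perfect: obtains x where "x \<in> C" "hamming_dist z x \<le> 3"
proof -
  have "card {y. \<exists>\<alpha>\<in>C. hamming_dist \<alpha> y \<in> {..3}} = card C * (\<Sum>r\<in>{..3}. CARD('n) choose r)"
  proof (rule card_union_spheres)
    show "2 * 3 < hamming_dist \<alpha> \<beta>" if "\<alpha> \<in> C" "\<beta> \<in> C" "\<alpha> \<noteq> \<beta>" for \<alpha> \<beta>
      using dist_ge_7[OF that] by simp
  qed auto
  also have "(\<Sum>r\<in>{..3}. CARD('n) choose r) = 2 ^ 11"
  proof -
    have "{..3} = {0, 1, 2, 3 :: nat}" by auto
    moreover have "3 * (23 choose 3) = (23::nat) * (22 choose 2)"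
      using binomial_absorption[of 2 23] by simp
    ultimately show ?thesis by (simp add: CARD_n choose_two)
  qed
  finally have "card {y. \<exists>\<alpha>\<in>C. hamming_dist \<alpha> y \<in> {..3}} = CARD(bit ^ 'n)"
    by (simp add: card_C CARD_vec CARD_bit CARD_n)
  then have "{y. \<exists>\<alpha>\<in>C. hamming_dist \<alpha> y \<in> {..3}} = UNIV"
    by (intro card_subset_eq) simp_all
  then have "\<exists>\<alpha>\<in>C. hamming_dist \<alpha> z \<in> {..3}" by blast
  then show thesis using that by (auto simp: hamming_dist_commute)
qed

lemma weight_ge_7: "x \<in> C \<Longrightarrow> x \<noteq> 0 \<Longrightarrow> 7 \<le> card (support x)"
  using dist_ge_7[of x 0] zero_mem by (simp add: weight_support)

text \<open>
  The codeword within distance 3 of a word of weight 4 is nonzero, so it has weight at least 7.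
  This forces its weight to be 7 and the 4-set to lie in its support.
\<close>

lemma weight_7_word:
  assumes "card T = 4"
  obtains x where "x \<in> C" "card (support x) = 7" "T \<subseteq> support x"
proof -
  obtain x where x: "x \<in> C" "hamming_dist (indicator_word T) x \<le> 3" by (rule perfect)
  have eq: "hamming_dist (indicator_word T) x + 2 * card (T \<inter> support x) = 4 + card (support x)"
    using dist_plus_2_inter[of "indicator_word T" x] assms by simp
  have "x \<noteq> 0" using eq x(2) by auto
  then have "7 \<le> card (support x)" using weight_ge_7 x(1) by blast
  moreover have "card (T \<inter> support x) \<le> 4"
    unfolding assms[symmetric] by (rule card_mono) auto
  ultimately have "card (support x) = 7" "card (T \<inter> support x) = 4" using eq x(2) by linarith+
  then have "T \<inter> support x = T" using assms by (intro card_subset_eq) auto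
  then show thesis using that x(1) \<open>card (support x) = 7\<close> by blast
qed

text \<open>
  Add to a 4-set a point outside the codeword of weight 7 containing it. A codeword of weight 7
  through the new 5-set would also contain the 4-set and hence be the old one, so the codeword
  near the 5-set has weight 8.
\<close>

lemma weight_8_word: obtains x where "x \<in> C" "card (support x) = 8" "j \<in> support x"
proof -
  have "3 \<le> card (UNIV - {j})" by (simp add: CARD_n)
  then obtain T' where T': "T' \<subseteq> UNIV - {j}" "card T' = 3" by (rule obtain_subset_with_card_n) blast
  define T where "T = insert j T'"
  have T: "card T = 4" "j \<in> T" using T' by (auto simp: T_def card_insert_if)
  obtain x where x: "x \<in> C" "card (support x) = 7" "T \<subseteq> support x"
    using weight_7_word[OF T(1)] by blast
  have "support x \<noteq> UNIV" using x(2) CARD_n by auto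
  then obtain p where p: "p \<notin> support x" by blast
  let ?S = "insert p T"
  have S: "card ?S = 5" using p x(3) T(1) by (auto simp: card_insert_if)
  obtain y where y: "y \<in> C" "hamming_dist (indicator_word ?S) y \<le> 3" by (rule perfect)
  have eq: "hamming_dist (indicator_word ?S) y + 2 * card (?S \<inter> support y) = 5 + card (support y)"
    using dist_plus_2_inter[of "indicator_word ?S" y] S by simp
  have "y \<noteq> 0" using eq y(2) by auto
  then have ge: "7 \<le> card (support y)" using weight_ge_7 y(1) by blast
  have le: "card (?S \<inter> support y) \<le> 5"
    unfolding S[symmetric] by (rule card_mono) auto
  have "card (?S \<inter> support y) = 5" using eq y(2) ge le by linarith
  then have "?S \<inter> support y = ?S" using S by (intro card_subset_eq) auto
  then have sub: "?S \<subseteq> support y" by blast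
  have "card (support y) \<noteq> 7"
  proof
    assume 7: "card (support y) = 7"
    have near: "hamming_dist (indicator_word T) z = 3" if "card (support z) = 7" "T \<subseteq> support z" for z
      using dist_plus_2_inter[of "indicator_word T" z] that T(1) by (simp add: Int_absorb2)
    have "x = y"
      by (rule codeword_unique[of x y "indicator_word T"]) (use near x y 7 sub in auto)
    then show False using p sub by blast
  qed
  then have "card (support y) = 8" using eq y(2) ge le by linarith
  then show thesis using that y(1) sub T(2) by blast
qed

subsection \<open>Puncturing\<close>

definition punctured :: "bit ^ 'n \<Rightarrow> bit ^ 'm" where
  "punctured x = (\<chi> i. x $ e i)"

lemma puncture_eq_image: "puncture e A = punctured ` A"
  by (auto simp: puncture_def punctured_def)

lemma punctured_add: "punctured (x + y) = punctured x + punctured y"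
  by (simp add: punctured_def vec_eq_iff)

lemma dist_punctured:
  "hamming_dist x y = hamming_dist (punctured x) (punctured y) + (if x $ j = y $ j then 0 else 1)"
proof -
  have "bij_betw e {i. x $ e i \<noteq> y $ e i} ({i. x $ i \<noteq> y $ i} - {j})"
  proof (rule bij_betw_subset[OF e])
    have range: "range e = UNIV - {j}" using e by (simp add: bij_betw_def)
    have "e ` {i. x $ e i \<noteq> y $ e i} = range e \<inter> {i. x $ i \<noteq> y $ i}" by blast
    also have "\<dots> = {i. x $ i \<noteq> y $ i} - {j}" unfolding range by blast
    finally show "e ` {i. x $ e i \<noteq> y $ e i} = {i. x $ i \<noteq> y $ i} - {j}" .
  qed simp
  from bij_betw_same_card[OF this]
  have "hamming_dist (punctured x) (punctured y) = card ({i. x $ i \<noteq> y $ i} - {j})"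
    by (simp add: hamming_dist_def punctured_def)
  moreover have "card D = card (D - {j}) + (if j \<in> D then 1 else 0)" for D :: "'n set"
    using card_Suc_Diff1[of D j] by simp
  note this[of "{i. x $ i \<noteq> y $ i}"]
  ultimately show ?thesis unfolding hamming_dist_def by simp
qed

lemma dist_punctured_eq:
  "x $ j = y $ j \<Longrightarrow> hamming_dist x y = hamming_dist (punctured x) (punctured y)"
  by (subst dist_punctured) simp

lemma dist_punctured_neq:
  "x $ j \<noteq> y $ j \<Longrightarrow> hamming_dist x y = hamming_dist (punctured x) (punctured y) + 1"
  by (subst dist_punctured) simp

lemma dist_punctured_le:
  "hamming_dist (punctured x) (punctured y) \<le> hamming_dist x y"
  "hamming_dist x y \<le> hamming_dist (punctured x) (punctured y) + 1"
  by (subst dist_punctured; simp)+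

lemma lift_word: obtains x where "punctured x = z" "x $ j = b"
proof
  have "e i \<noteq> j" for i using e by (auto simp: bij_betw_def)
  moreover have "inv_into UNIV e (e i) = i" for i using e by (simp add: bij_betw_def)
  ultimately show "punctured (\<chi> i. if i = j then b else z $ inv_into UNIV e i) = z"
    by (simp add: punctured_def vec_eq_iff)
qed simp

lemma punctured_eqD:
  assumes "x \<in> C" "y \<in> C" "punctured x = punctured y"
  shows "x = y"
proof (rule ccontr)
  assume "x \<noteq> y"
  then have "7 \<le> hamming_dist x y" using assms by (intro dist_ge_7)
  moreover have "hamming_dist (punctured x) (punctured y) = 0" by (simp add: assms(3))
  ultimately show False using dist_punctured_le(2)[of x y] by linarith
qed

subsection \<open>The two parity classes\<close>

definition parity_class :: "bool \<Rightarrow> (bit ^ 'n) set" where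
  "parity_class b = {x \<in> C. even (card (support x)) = b}"

lemma even_weight_add: "even (hamming_dist x y) \<longleftrightarrow> (even (card (support x)) \<longleftrightarrow> even (card (support y)))"
  proof -
  have "a + 2 * b = c + d \<Longrightarrow> even a \<longleftrightarrow> (even c \<longleftrightarrow> even d)" for a b c d :: nat
    by presburger
  then show ?thesis using dist_plus_2_inter[of x y] .
qed

lemma even_subcode: "even_weight_subcode C = parity_class True"
  by (simp add: even_weight_subcode_def parity_class_def)

lemma weight_7_word_at_j: obtains x where "x \<in> C" "card (support x) = 7" "j \<in> support x"
proof -
  have "3 \<le> card (UNIV - {j})" by (simp add: CARD_n)
  then obtain T' where T': "T' \<subseteq> UNIV - {j}" "card T' = 3" by (rule obtain_subset_with_card_n) blast
  have "card (insert j T') = 4" using T' by (auto simp: card_insert_if)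
  then obtain x where "x \<in> C" "card (support x) = 7" "insert j T' \<subseteq> support x"
    by (rule weight_7_word)
  then show thesis using that by simp
qed

text \<open>
  If both punctured codewords were near \<open>z\<close>, the codewords themselves would be at distance at most
  \<open>3 + 2 + 1\<close>, where 1 accounts for the coordinate \<open>j\<close>.
\<close>

lemma punctured_code_far:
  assumes "x \<in> C" "y \<in> C" "x \<noteq> y" "hamming_dist z (punctured x) \<le> 3"
  shows "3 \<le> hamming_dist z (punctured y)"
  using dist_ge_7[OF assms(1-3)] assms(4) dist_punctured_le(2)[of x y]
    hamming_dist_commute[of "punctured x" z]
    hamming_dist_triangle[of "punctured x" "punctured y" z] by linarith

text \<open>
  Let \<open>x\<close> be a codeword with \<open>punctured x\<close> at distance 3 from \<open>z\<close>, and lift \<open>z\<close> to a word \<open>w\<close> that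
  differs from \<open>x\<close> at \<open>j\<close>, hence is at distance 4 from \<open>x\<close>. The codeword \<open>y\<close> within distance 3 of \<open>w\<close>
  must then be at distance exactly 7 from \<open>x\<close>. So it has the other parity, and \<open>punctured y\<close> is
  also within distance 3 of \<open>z\<close>.
\<close>

lemma dist_3_other_parity:
  assumes "dist_to_code z (punctured ` parity_class b) = 3" "parity_class b \<noteq> {}"
  shows "dist_to_code z (punctured ` parity_class (\<not> b)) = 3"
proof -
  obtain x where x: "x \<in> parity_class b" "hamming_dist z (punctured x) = 3"
    using assms dist_to_code_eq_iff[of "punctured ` parity_class b" z 3] by auto
  obtain w where w: "punctured w = z" "w $ j = x $ j + 1" by (rule lift_word)
  have wx: "hamming_dist w x = 4"
  proof -
    have "w $ j \<noteq> x $ j" unfolding w(2) by simp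
    from dist_punctured_neq[OF this] show ?thesis unfolding w(1) x(2) by simp
  qed
  obtain y where y: "y \<in> C" "hamming_dist w y \<le> 3" by (rule perfect)
  have "x \<in> C" using x(1) by (simp add: parity_class_def)
  have "x \<noteq> y" using wx y(2) by auto
  have "hamming_dist x y = 7"
    using dist_ge_7[OF \<open>x \<in> C\<close> y(1) \<open>x \<noteq> y\<close>] hamming_dist_triangle[of x y w] wx y(2)
      hamming_dist_commute[of x w] by linarith
  then have "even (card (support x)) \<noteq> even (card (support y))"
    using even_weight_add[of x y] by simp
  then have "y \<in> parity_class (\<not> b)"
    using x(1) y(1) by (cases b) (simp_all add: parity_class_def)
  have far: "3 \<le> hamming_dist z (punctured y')" if "y' \<in> parity_class (\<not> b)" for y'
  proof (rule punctured_code_far[OF \<open>x \<in> C\<close>])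
    show "y' \<in> C" "x \<noteq> y'" using that x(1) by (auto simp: parity_class_def)
    show "hamming_dist z (punctured x) \<le> 3" using x(2) by simp
  qed
  have "hamming_dist z (punctured y) \<le> 3"
    using dist_punctured_le(1)[of w y] y(2) unfolding w(1) by linarith
  then have "hamming_dist z (punctured y) = 3"
    using far[OF \<open>y \<in> parity_class (\<not> b)\<close>] by simp
  moreover have "punctured ` parity_class (\<not> b) \<noteq> {}" using \<open>y \<in> parity_class (\<not> b)\<close> by blast
  ultimately show ?thesis
    using \<open>y \<in> parity_class (\<not> b)\<close> far by (subst dist_to_code_eq_iff) auto
qed

lemma zero_even: "0 \<in> parity_class True"
  using zero_mem by (simp add: parity_class_def)

lemma parity_class_add:
  assumes "x \<in> parity_class b" "y \<in> parity_class c"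
  shows "x + y \<in> parity_class (b = c)"
proof -
  have "card (support (x + y)) = hamming_dist x y"
    by (metis weight_support bit_vec_diff hamming_dist_diff_0)
  then show ?thesis
    using assms even_weight_add[of x y] add_mem by (simp add: parity_class_def)
qed

lemma translate_parity_class:
  assumes "x \<in> parity_class False"
  shows "(\<lambda>y. y + x) ` parity_class True = parity_class False"
proof
  show "(\<lambda>y. y + x) ` parity_class True \<subseteq> parity_class False"
    using parity_class_add[OF _ assms, of _ True] by auto
  show "parity_class False \<subseteq> (\<lambda>y. y + x) ` parity_class True"
  proof
    fix y assume "y \<in> parity_class False"
    then have "y + x \<in> parity_class True" using parity_class_add[OF _ assms] by fastforce
    then show "y \<in> (\<lambda>y. y + x) ` parity_class True" by (intro image_eqI[of _ _ "y + x"]) simp_all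
  qed
qed

lemma neighbours_3_parity:
  "neighbours (punctured ` parity_class False) 3 = neighbours (punctured ` parity_class True) 3"
proof -
  obtain x where "x \<in> C" "card (support x) = 7" by (rule weight_7_word_at_j)
  then have "parity_class False \<noteq> {}" by (auto simp: parity_class_def)
  moreover have "parity_class True \<noteq> {}" using zero_even by blast
  ultimately show ?thesis
    using dist_3_other_parity[of _ True] dist_3_other_parity[of _ False]
    by (auto simp: neighbours_def)
qed

text \<open>
  The word has three of the seven support points of an odd codeword through \<open>j\<close>, avoiding \<open>j\<close>.
  After puncturing it is at distance 3 both from zero and from that odd codeword, and the latter
  keeps all even codewords at distance at least 3.
\<close>

lemma neighbours_3_nonempty: "neighbours (punctured ` parity_class True) 3 \<noteq> {}"
proof -
  obtain x where x: "x \<in> C" "card (support x) = 7" "j \<in> support x" by (rule weight_7_word_at_j)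
  have "3 \<le> card (support x - {j})" using x by simp
  then obtain T where T: "T \<subseteq> support x - {j}" "card T = 3" by (rule obtain_subset_with_card_n) blast
  let ?w = "indicator_word T"
  have j: "?w $ j = 0" using T(1) by (auto simp: indicator_word_def)
  have "T \<inter> support x = T" using T(1) by blast
  then have "hamming_dist ?w x = 4" using dist_plus_2_inter[of ?w x] x(2) T(2) by simp
  then have near: "hamming_dist (punctured ?w) (punctured x) = 3"
    using dist_punctured_neq[of ?w x] j x(3) by simp
  have "hamming_dist ?w 0 = 3" using T(2) by (simp add: weight_support)
  then have "hamming_dist (punctured ?w) (punctured 0) = 3"
    using dist_punctured_eq[of ?w 0] j by simp
  moreover have "3 \<le> hamming_dist (punctured ?w) (punctured y)" if "y \<in> parity_class True" for y
  proof (rule punctured_code_far[OF x(1)])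
    show "y \<in> C" "x \<noteq> y" using that x(2) by (auto simp: parity_class_def)
    show "hamming_dist (punctured ?w) (punctured x) \<le> 3" using near by simp
  qed
  ultimately have "dist_to_code (punctured ?w) (punctured ` parity_class True) = 3"
    using zero_even by (subst dist_to_code_eq_iff) auto
  then show ?thesis by (auto simp: neighbours_def)
qed

lemma elusive_punctured: "elusive 3 (puncture e (even_weight_subcode C))"
proof -
  let ?D = "\<lambda>b. punctured ` parity_class b"
  obtain x where "x \<in> C" "card (support x) = 7" by (rule weight_7_word_at_j)
  then have x: "x \<in> parity_class False" by (simp add: parity_class_def)
  have image: "(\<lambda>\<alpha>. \<alpha> + punctured x) ` ?D True = ?D False"
    unfolding translate_parity_class[OF x, symmetric] by (simp add: image_image punctured_add)
  have "elusive 3 (?D True)"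
  proof (rule elusive_translateI)
    show "neighbours (?D True) 3 \<noteq> {}" by (rule neighbours_3_nonempty)
    show "(\<lambda>\<alpha>. \<alpha> + punctured x) ` ?D True \<noteq> ?D True"
    proof
      assume "(\<lambda>\<alpha>. \<alpha> + punctured x) ` ?D True = ?D True"
      then have "punctured x \<in> ?D True" using x unfolding image by blast
      then obtain y where y: "y \<in> parity_class True" "punctured x = punctured y" by blast
      then have "x = y" using x punctured_eqD[of x y] by (simp add: parity_class_def)
      then show False using x y(1) by (simp add: parity_class_def)
    qed
    show "(\<lambda>\<alpha>. \<alpha> + punctured x) ` neighbours (?D True) 3 = neighbours (?D True) 3"
      unfolding neighbours_image[OF translation_HammingAut, symmetric] image
      by (rule neighbours_3_parity)
  qed simp
  then show ?thesis by (simp only: puncture_eq_image even_subcode)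
qed

lemma card_even_class: "card (parity_class True) = 2 ^ 11"
proof -
  obtain x where "x \<in> C" "card (support x) = 7" by (rule weight_7_word_at_j)
  then have x: "x \<in> parity_class False" by (simp add: parity_class_def)
  have "card (parity_class False) = card (parity_class True)"
    unfolding translate_parity_class[OF x, symmetric] by (rule card_image) (simp add: inj_on_def)
  moreover have "card (parity_class True \<union> parity_class False)
      = card (parity_class True) + card (parity_class False)"
    by (rule card_Un_disjoint) (auto simp: parity_class_def)
  moreover have "parity_class True \<union> parity_class False = C"
    by (auto simp: parity_class_def)
  ultimately have "card C = 2 * card (parity_class True)" by simp
  then show ?thesis by (simp add: card_C)
qed

lemma punctured_0: "punctured 0 = 0"
  by (simp add: punctured_def vec_eq_iff)

lemma subspace_punctured: "vec.subspace (punctured ` parity_class True)"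
proof (rule vec.subspaceI)
  show "0 \<in> punctured ` parity_class True" using zero_even punctured_0 by (metis imageI)
  fix x y assume "x \<in> punctured ` parity_class True" "y \<in> punctured ` parity_class True"
  then show "x + y \<in> punctured ` parity_class True"
    using parity_class_add[of _ True _ True] by (auto simp: punctured_add[symmetric])
next
  fix c :: bit and x assume "x \<in> punctured ` parity_class True"
  then show "c *s x \<in> punctured ` parity_class True"
    using zero_even punctured_0 by (cases c) (auto intro: image_eqI[of _ _ 0])
qed

lemma punctured_code_params: "linear_code_params (puncture e (even_weight_subcode C)) 22 11 7"
proof -
  let ?D = "punctured ` parity_class True"
  have "inj_on punctured (parity_class True)"
    using punctured_eqD by (auto simp: inj_on_def parity_class_def)
  then have "card ?D = CARD(bit) ^ 11"
    by (simp add: card_image card_even_class CARD_bit)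
  then have "vec.dim ?D = 11" by (rule dim_subspace_eqI[OF subspace_punctured])
  moreover have "min_distance ?D = 7"
  proof -
    obtain x where x: "x \<in> C" "card (support x) = 8" "j \<in> support x" by (rule weight_8_word)
    have w: "hamming_dist (punctured x) 0 = 7"
      using dist_punctured_neq[of x 0] x(2,3) by (simp add: weight_support[of x] punctured_0)
    show ?thesis
    proof (rule min_distance_subspace_eqI[OF subspace_punctured])
      show "punctured x \<in> ?D" using x by (auto simp: parity_class_def)
      show "hamming_dist (punctured x) 0 = 7" by (rule w)
      then show "punctured x \<noteq> 0" by auto
    next
      fix z assume "z \<in> ?D" "z \<noteq> 0"
      then obtain y where y: "y \<in> parity_class True" "z = punctured y" "y \<noteq> 0"
        using punctured_0 by auto
      then have "7 \<le> card (support y)" "even (card (support y))"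
        using weight_ge_7 by (auto simp: parity_class_def)
      then have "8 \<le> card (support y)" by (cases "card (support y) = 7") auto
      then show "7 \<le> hamming_dist z 0"
        using dist_punctured_le(2)[of y 0] unfolding y(2) punctured_0 weight_support[of y] by linarith
    qed
  qed
  ultimately show ?thesis
    using subspace_punctured by (simp add: linear_code_params_def CARD_m puncture_eq_image even_subcode)
qed

end


section \<open>The three families of elusive codes\<close>

theorem theorem1p1:
  shows
    "(\<forall>q d. CARD('q::{field,finite}) = q \<and> CARD('d::finite) = d \<and> (q = 2 \<longrightarrow> d \<ge> 2) \<longrightarrow>
        completely_transitive (reed_muller :: ('q ^ ('q ^ 'd)) set) \<and>
        elusive 1 (reed_muller :: ('q ^ ('q ^ 'd)) set) \<and>
        linear_code_params (reed_muller :: ('q ^ ('q ^ 'd)) set)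
          (q ^ d) (q ^ d - d - 1) (if q = 2 then 4 else 3)) \<and>
     (\<forall>d \<sigma>. d \<ge> 2 \<and> CARD('f::{field,finite}) = 2 ^ (2 * d - 1) \<and>
        preparata_exponent TYPE('f) \<sigma> \<longrightarrow>
        \<not> vec.subspace (preparata \<sigma> :: (bit ^ ('f + 'f)) set) \<and>
        elusive 2 (preparata \<sigma> :: (bit ^ ('f + 'f)) set) \<and>
        min_distance (preparata \<sigma> :: (bit ^ ('f + 'f)) set) = 6 \<and>
        card (preparata \<sigma> :: (bit ^ ('f + 'f)) set) = 2 ^ (2 ^ (2 * d) - 4 * d)) \<and>
     (\<forall>(C :: (bit ^ 'n) set) j (e :: 'm::finite \<Rightarrow> 'n::finite).
        binary_golay C \<and> bij_betw e UNIV (UNIV - {j}) \<longrightarrow>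
        elusive 3 (puncture e (even_weight_subcode C)) \<and>
        linear_code_params (puncture e (even_weight_subcode C)) 22 11 7)"
proof (rule conjI[OF _ conjI]; intro allI impI)
  fix q d
  assume "CARD('q) = q \<and> CARD('d) = d \<and> (q = 2 \<longrightarrow> d \<ge> 2)"
  then have q: "CARD('q) = q" and d: "CARD('d) = d" and small: "CARD('q) = 2 \<longrightarrow> CARD('d) \<ge> 2"
    by auto
  show "completely_transitive (reed_muller :: ('q ^ ('q ^ 'd)) set) \<and>
      elusive 1 (reed_muller :: ('q ^ ('q ^ 'd)) set) \<and>
      linear_code_params (reed_muller :: ('q ^ ('q ^ 'd)) set)
        (q ^ d) (q ^ d - d - 1) (if q = 2 then 4 else 3)"
    using completely_transitive_reed_muller elusive_reed_muller
      linear_code_params_reed_muller[OF small, unfolded q d] by (intro conjI)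
next
  fix d \<sigma>
  assume "d \<ge> 2 \<and> CARD('f) = 2 ^ (2 * d - 1) \<and> preparata_exponent TYPE('f) \<sigma>"
  then interpret preparata_field "TYPE('f)" d \<sigma> by unfold_locales auto
  show "\<not> vec.subspace (preparata \<sigma> :: (bit ^ ('f + 'f)) set) \<and>
      elusive 2 (preparata \<sigma> :: (bit ^ ('f + 'f)) set) \<and>
      min_distance (preparata \<sigma> :: (bit ^ ('f + 'f)) set) = 6 \<and>
      card (preparata \<sigma> :: (bit ^ ('f + 'f)) set) = 2 ^ (2 ^ (2 * d) - 4 * d)"
    using preparata_not_subspace elusive_preparata min_distance_preparata card_preparata
    by (intro conjI)
next
  fix C :: "(bit ^ 'n) set" and j and e :: "'m \<Rightarrow> 'n"
  assume "binary_golay C \<and> bij_betw e UNIV (UNIV - {j})"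
  then interpret golay C j e by unfold_locales auto
  show "elusive 3 (puncture e (even_weight_subcode C)) \<and>
      linear_code_params (puncture e (even_weight_subcode C)) 22 11 7"
    using elusive_punctured punctured_code_params by (intro conjI)
qed

end
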